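(* For every $n\geq 2$, the $n$-th symmetric product $SP^n\big(\bigvee_{i=1}^{n+1}S_i\big)$ of a bouquet of $n+1$ circles cannot be embedded in any product of $n$ curves.
   Context: A bouquet of circles $\bigvee_{i=1}^{n+1}S_i$ is a union of $n+1$ topological circles any two of which meet exactly in a common base point. $SP^n(X)$ is the orbit space of $X^n$ under the action of the symmetric group $S_n$ permuting coordinates. A curve is a $1$-dimensional continuum (compact connected metric space). *)

theory Defs
  imports "HOL-Analysis.Analysis" "HOL-Library.Multiset"
begin

text \<open>Bouquet of n+1 circles: the circles |z - k| = k in the complex plane, k = 1..n+1.
  Any two of them meet exactly in the common base point 0.\<close>
definition bouquet :: "nat \<Rightarrow> complex set" where
  "bouquet n = (\<Union>k\<in>{1..n+1}. sphere (of_nat k) (of_nat k))"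

definition bouquet_top :: "nat \<Rightarrow> complex topology" where
  "bouquet_top n = top_of_set (bouquet n)"

definition quotient_top :: "'a topology \<Rightarrow> ('a \<Rightarrow> 'b) \<Rightarrow> 'b topology" where
  "quotient_top X q = topology (\<lambda>U. U \<subseteq> q ` topspace X \<and> openin X {x \<in> topspace X. q x \<in> U})"

text \<open>X^n as the product topology on functions indexed by {..<n}; the orbit of a tuple
  under the symmetric group is recorded by the multiset of its coordinates.\<close>
definition orbit_of_tuple :: "nat \<Rightarrow> (nat \<Rightarrow> 'a) \<Rightarrow> 'a multiset" where
  "orbit_of_tuple n f = image_mset f (mset_set {..<n})"

definition SP :: "nat \<Rightarrow> 'a topology \<Rightarrow> 'a multiset topology" where
  "SP n X = quotient_top (product_topology (\<lambda>i. X) {..<n}) (orbit_of_tuple n)"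

definition covering_dim_le :: "'a topology \<Rightarrow> nat \<Rightarrow> bool" where
  "covering_dim_le X m \<longleftrightarrow>
    (\<forall>\<U>. finite \<U> \<and> (\<forall>U\<in>\<U>. openin X U) \<and> \<Union>\<U> = topspace X \<longrightarrow>
      (\<exists>\<V>. finite \<V> \<and> (\<forall>V\<in>\<V>. openin X V) \<and> \<Union>\<V> = topspace X \<and>
           (\<forall>V\<in>\<V>. \<exists>U\<in>\<U>. V \<subseteq> U) \<and>
           (\<forall>x\<in>topspace X. card {V\<in>\<V>. x \<in> V} \<le> m + 1)))"

definition covering_dim_eq :: "'a topology \<Rightarrow> nat \<Rightarrow> bool" where
  "covering_dim_eq X m \<longleftrightarrow> covering_dim_le X m \<and> (m = 0 \<or> \<not> covering_dim_le X (m - 1))"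

definition is_curve :: "'a topology \<Rightarrow> bool" where
  "is_curve Y \<longleftrightarrow> topspace Y \<noteq> {} \<and> compact_space Y \<and> connected_space Y \<and>
     metrizable_space Y \<and> covering_dim_eq Y 1"

end

(* The n-skeleton of the (n+1)-torus - the tuples of points of n+1 circles at least one of which is the
   base point - embeds in SP^n of the bouquet: forget one base point and then the order.  Let it be
   embedded in a product of n curves.  Since the curves have dimension 1, each has a fine finite cover
   whose nerve is a graph, and pulling back 1-cochains of these n graphs gives 1-cocycles on a fine cubical
   grid of the skeleton.  Two cocycles from the same graph have cup product zero already as cochains, so
   evaluating on the 2-tori, which lie in the skeleton because n >= 2, shows that their period vectors in
   R^(n+1) are proportional.  Hence on the n-dimensional coordinate tori every product of n cocycles, one from
   each graph, is a multiple of one and the same function.  On the other hand the covers are so fine that the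
   coordinate cocycles of the torus factor through the nerves, so that products of their restrictions
   are combinations of those products; but they take independent values on the n+1 coordinate tori. *)
theory Submission
  imports Defs
begin

section \<open>Cup products on the cubical torus\<close>

text \<open>The label of a cube in one curve is the set of cover members that contain the image of
  the whole cube; all that is known is that it shrinks when the cube grows. This is why the chains
  are flags of cubes, and why a 1-cochain of a nerve records the passage from an edge (two cover
  members) to a vertex (one). No homology is set up: a cocycle on a torus is the increment of a
  quasi-periodic potential on the lattice, and the signed sum of a product of \<open>m\<close>
  cocycles over all flags is the determinant of their period vectors. In \<open>n\<close> steps each
  of \<open>n\<close> labels can drop at most once. So if every step changes some label, each label
  drops exactly once, and the whole sequence of labels is detected by one cocycle from each graph.
  Constants: factoring a coordinate through the nerves displaces it by less than 1/8 of a circle,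
  and a lattice step is at most 1/16; as 1/16 + 1/8 + 1/8 < 1/2, increments modulo 1 still lift
  consistently. Two of the \<open>n+1\<close> coordinate tori suffice: a 2 by 2 matrix of rank at
  most one is not the identity.\<close>

lemma sum_involution_zero:
  fixes X :: "'z \<Rightarrow> real"
  assumes "\<And>z. z \<in> A \<Longrightarrow> \<sigma> z \<in> A" "\<And>z. z \<in> A \<Longrightarrow> \<sigma> (\<sigma> z) = z"
    "\<And>z. z \<in> A \<Longrightarrow> X (\<sigma> z) = - X z"
  shows "sum X A = 0"
proof -
  have "bij_betw \<sigma> A A"
    by (rule bij_betw_byWitness[where f' = \<sigma>]) (use assms in auto)
  then have "sum X A = (\<Sum>z\<in>A. X (\<sigma> z))"
    by (simp add: sum.reindex_bij_betw)
  also have "\<dots> = - sum X A"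
    using assms(3) by (simp add: sum_negf)
  finally show ?thesis by simp
qed

text \<open>A simplex \<open>(p, s, \<pi>)\<close> of the barycentric subdivision of the cubical lattice starts at the even point \<open>p\<close>
(a vertex of the cubulation) and moves the coordinates \<open>\<pi> 0, \<pi> 1, \<dots>\<close> one after the other by the signs in \<open>s\<close>;
a lattice point stands for the cube whose extended directions are its odd coordinates.\<close>

definition vertex :: "(nat \<Rightarrow> int) \<times> (nat \<Rightarrow> int) \<times> (nat \<Rightarrow> nat) \<Rightarrow> nat \<Rightarrow> nat \<Rightarrow> int" where
  "vertex = (\<lambda>(p, s, \<pi>) k c. if c \<in> \<pi> ` {..<k} then p c + s c else p c)"

definition top_simplices :: "nat \<Rightarrow> int \<Rightarrow> ((nat \<Rightarrow> int) \<times> (nat \<Rightarrow> int) \<times> (nat \<Rightarrow> nat)) set" where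
  "top_simplices m R = ({..<m} \<rightarrow>\<^sub>E {t. even t \<and> 0 \<le> t \<and> t < R}) \<times> ({..<m} \<rightarrow>\<^sub>E {-1, 1}) \<times> {\<pi>. \<pi> permutes {..<m}}"

definition orientation :: "nat \<Rightarrow> (nat \<Rightarrow> int) \<times> (nat \<Rightarrow> int) \<times> (nat \<Rightarrow> nat) \<Rightarrow> real" where
  "orientation m = (\<lambda>(p, s, \<pi>). of_int (sign \<pi>) * (\<Prod>c<m. of_int (s c)))"

text \<open>Evaluation of an \<open>m\<close>-cochain on the fundamental cycle of the
  \<open>m\<close>-torus of side \<open>R\<close>. The cochain may be any function of the vertex
  sequence, so that a cancellation can be expressed by saying which vertex it ignores.\<close>

definition cycle_sum :: "nat \<Rightarrow> int \<Rightarrow> ((nat \<Rightarrow> nat \<Rightarrow> int) \<Rightarrow> real) \<Rightarrow> real" where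
  "cycle_sum m R \<Psi> = (\<Sum>z\<in>top_simplices m R. orientation m z * \<Psi> (vertex z))"

lemma finite_top_simplices: "finite (top_simplices m R)"
proof -
  have "finite {t::int. even t \<and> 0 \<le> t \<and> t < R}"
    by (rule finite_subset[of _ "{0..<R}"]) auto
  then show ?thesis
    unfolding top_simplices_def by (intro finite_cartesian_product finite_PiE finite_permutations) auto
qed

lemma cycle_sum_diff: "cycle_sum m R (\<lambda>v. \<Phi> v - \<Psi> v) = cycle_sum m R \<Phi> - cycle_sum m R \<Psi>"
  by (simp add: cycle_sum_def algebra_simps sum_subtractf)

lemma cycle_sum_add: "cycle_sum m R (\<lambda>v. \<Phi> v + \<Psi> v) = cycle_sum m R \<Phi> + cycle_sum m R \<Psi>"
  by (simp add: cycle_sum_def algebra_simps sum.distrib)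

text \<open>The oriented sum of all top simplices of the torus is a cycle: a summand that ignores one vertex
cancels against the neighbouring simplex across the opposite face.\<close>

lemma cycle_sum_zero_interior:
  assumes k: "0 < k" "k < m"
    and ind: "\<And>v w. (\<And>j. j \<noteq> k \<Longrightarrow> v j = w j) \<Longrightarrow> \<Psi> v = \<Psi> w"
  shows "cycle_sum m R \<Psi> = 0"
proof -
  \<comment> \<open>Exchanging the moves number \<open>k - 1\<close> and \<open>k\<close> changes
    vertex \<open>k\<close> alone and reverses the sign of the permutation.\<close>
  define \<tau> where "\<tau> = Transposition.transpose (k - 1) k"
  have \<tau>: "\<tau> permutes {..<m}" "\<tau> \<circ> \<tau> = id" "sign \<tau> = -1"
    using k by (auto simp: \<tau>_def sign_swap_id intro!: permutes_swap_id)
  have im: "\<tau> ` {..<j} = {..<j}" if "j \<noteq> k" for j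
  proof (cases "j < k")
    case True
    then have "\<tau> x = x" if "x < j" for x
      using that by (auto simp: \<tau>_def Transposition.transpose_def)
    then show ?thesis by auto
  next
    case False
    then have "\<tau> permutes {..<j}"
      using k \<open>j \<noteq> k\<close> by (auto simp: \<tau>_def intro!: permutes_swap_id)
    then show ?thesis by (rule permutes_image)
  qed
  have vt: "vertex (p, s, \<pi> \<circ> \<tau>) j = vertex (p, s, \<pi>) j" if "j \<noteq> k" for p s \<pi> j
    unfolding vertex_def prod.case image_comp[symmetric] im[OF that] ..
  show ?thesis
    unfolding cycle_sum_def
  proof (rule sum_involution_zero[where \<sigma> = "\<lambda>(p, s, \<pi>). (p, s, \<pi> \<circ> \<tau>)"])
    fix z assume z: "z \<in> top_simplices m R"
    then obtain p s \<pi> where [simp]: "z = (p, s, \<pi>)" and pi: "\<pi> permutes {..<m}"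
      by (auto simp: top_simplices_def)
    show "(case z of (p, s, \<pi>) \<Rightarrow> (p, s, \<pi> \<circ> \<tau>)) \<in> top_simplices m R"
      using z \<tau>(1) by (auto simp: top_simplices_def permutes_compose)
    show "(case (case z of (p, s, \<pi>) \<Rightarrow> (p, s, \<pi> \<circ> \<tau>)) of (p, s, \<pi>) \<Rightarrow> (p, s, \<pi> \<circ> \<tau>)) = z"
      using \<tau>(2) by (simp add: comp_assoc)
    have "sign (\<pi> \<circ> \<tau>) = - sign \<pi>"
      using pi \<tau> by (subst sign_compose) (auto intro: permutation_permutes[THEN iffD2])
    moreover have "\<Psi> (vertex (p, s, \<pi> \<circ> \<tau>)) = \<Psi> (vertex (p, s, \<pi>))"
      by (rule ind) (rule vt)
    ultimately show "orientation m (case z of (p, s, \<pi>) \<Rightarrow> (p, s, \<pi> \<circ> \<tau>)) *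
         \<Psi> (vertex (case z of (p, s, \<pi>) \<Rightarrow> (p, s, \<pi> \<circ> \<tau>))) = - (orientation m z * \<Psi> (vertex z))"
      by (simp add: orientation_def)
  qed
qed

lemma prod_upd_uminus:
  fixes k m :: nat
  assumes "k < m"
  shows "(\<Prod>c<m. real_of_int ((s(k := - s k)) c)) = - (\<Prod>c<m. of_int (s c))"
proof -
  have "(\<Prod>c\<in>{..<m}-{k}. real_of_int ((s(k := - s k)) c)) = (\<Prod>c\<in>{..<m}-{k}. of_int (s c))"
    by (rule prod.cong) auto
  then show ?thesis
    using prod.remove[of "{..<m}" k "\<lambda>c. real_of_int ((s(k := - s k)) c)"]
      prod.remove[of "{..<m}" k "\<lambda>c. real_of_int (s c)"] assms by simp
qed

text \<open>The neighbour across the face without the last vertex lies in the adjacent cube: its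
  last move goes the opposite way.\<close>

lemma cycle_sum_zero_top:
  assumes m: "0 < m"
    and ind: "\<And>v w. (\<And>j. j < m \<Longrightarrow> v j = w j) \<Longrightarrow> \<Psi> v = \<Psi> w"
  shows "cycle_sum m R \<Psi> = 0"
  unfolding cycle_sum_def
proof (rule sum_involution_zero[where \<sigma> = "\<lambda>(p, s, \<pi>). (p, s(\<pi> (m - 1) := - s (\<pi> (m - 1))), \<pi>)"])
  fix z assume z: "z \<in> top_simplices m R"
  then obtain p s \<pi> where [simp]: "z = (p, s, \<pi>)" and pi: "\<pi> permutes {..<m}"
    and s: "s \<in> {..<m} \<rightarrow>\<^sub>E {-1, 1}"
    by (auto simp: top_simplices_def)
  define k where "k = \<pi> (m - 1)"
  have k: "k < m" using permutes_in_image[OF pi, of "m - 1"] m by (simp add: k_def)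
  have "s(k := - s k) \<in> {..<m} \<rightarrow>\<^sub>E {-1, 1}"
    using s k by (auto simp: PiE_iff extensional_def)
  then show "(case z of (p, s, \<pi>) \<Rightarrow> (p, s(\<pi> (m - 1) := - s (\<pi> (m - 1))), \<pi>)) \<in> top_simplices m R"
    using z by (simp add: top_simplices_def k_def)
  show "(case (case z of (p, s, \<pi>) \<Rightarrow> (p, s(\<pi> (m - 1) := - s (\<pi> (m - 1))), \<pi>)) of
            (p, s, \<pi>) \<Rightarrow> (p, s(\<pi> (m - 1) := - s (\<pi> (m - 1))), \<pi>)) = z"
    by simp
  have "k \<notin> \<pi> ` {..<j}" if "j < m" for j
    using that m by (auto simp: k_def inj_eq[OF permutes_inj[OF pi]])
  then have "vertex (p, s(k := - s k), \<pi>) j = vertex (p, s, \<pi>) j" if "j < m" for j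
    using that by (auto simp: vertex_def fun_eq_iff)
  then have "\<Psi> (vertex (p, s(k := - s k), \<pi>)) = \<Psi> (vertex (p, s, \<pi>))"
    by (rule ind)
  moreover have "orientation m (p, s(k := - s k), \<pi>) = - orientation m (p, s, \<pi>)"
    unfolding orientation_def prod.case prod_upd_uminus[OF k] by simp
  ultimately show "orientation m (case z of (p, s, \<pi>) \<Rightarrow> (p, s(\<pi> (m - 1) := - s (\<pi> (m - 1))), \<pi>)) *
       \<Psi> (vertex (case z of (p, s, \<pi>) \<Rightarrow> (p, s(\<pi> (m - 1) := - s (\<pi> (m - 1))), \<pi>))) =
       - (orientation m z * \<Psi> (vertex z))"
    by (simp add: k_def)
qed

definition periodic :: "nat \<Rightarrow> int \<Rightarrow> ((nat \<Rightarrow> nat \<Rightarrow> int) \<Rightarrow> real) \<Rightarrow> bool" where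
  "periodic m R \<Psi> \<longleftrightarrow> (\<forall>v k. k < m \<longrightarrow> \<Psi> (\<lambda>j. (v j)(k := v j k + R)) = \<Psi> v)"

text \<open>The first edge can also be started from its other end: \<open>p\<close> moves by
  \<open>2 * s\<close> in direction \<open>\<pi> 0\<close> and the sign is reversed. Reducing the
  new start modulo \<open>R\<close> shifts the later vertices by a common multiple of
  \<open>R\<close>, which \<open>periodic\<close> absorbs.\<close>

lemma cycle_sum_zero_bottom:
  assumes m: "0 < m" and R: "even R" "0 < R"
    and ind: "\<And>v w. (\<And>j. 0 < j \<Longrightarrow> v j = w j) \<Longrightarrow> \<Psi> v = \<Psi> w"
    and per: "periodic m R \<Psi>"
  shows "cycle_sum m R \<Psi> = 0"
proof -
  define \<sigma> :: "(nat \<Rightarrow> int) \<times> (nat \<Rightarrow> int) \<times> (nat \<Rightarrow> nat) \<Rightarrow> _"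
    where "\<sigma> = (\<lambda>(p, s, \<pi>). (p(\<pi> 0 := (p (\<pi> 0) + 2 * s (\<pi> 0)) mod R),
                                 s(\<pi> 0 := - s (\<pi> 0)), \<pi>))"
  show ?thesis
    unfolding cycle_sum_def
  proof (rule sum_involution_zero[where \<sigma> = \<sigma>])
    fix z assume z: "z \<in> top_simplices m R"
    then obtain p s \<pi> where zz[simp]: "z = (p, s, \<pi>)" and pi: "\<pi> permutes {..<m}"
      and s: "s \<in> {..<m} \<rightarrow>\<^sub>E {-1, 1}" and p: "p \<in> {..<m} \<rightarrow>\<^sub>E {t. even t \<and> 0 \<le> t \<and> t < R}"
      by (auto simp: top_simplices_def)
    define k where "k = \<pi> 0"
    have k: "k < m" using permutes_in_image[OF pi, of 0] m by (simp add: k_def)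
    have \<sigma>z: "\<sigma> z = (p(k := (p k + 2 * s k) mod R), s(k := - s k), \<pi>)"
      by (simp add: \<sigma>_def k_def)
    have pk: "even (p k)" "0 \<le> p k" "p k < R" and sk: "s k = 1 \<or> s k = -1"
      using p s k by (auto simp: PiE_iff)
    have "s(k := - s k) \<in> {..<m} \<rightarrow>\<^sub>E {-1, 1}"
      using s k by (auto simp: PiE_iff extensional_def)
    moreover have "even ((p k + 2 * s k) mod R)"
      using R pk by (simp add: dvd_mod)
    then have "p(k := (p k + 2 * s k) mod R) \<in> {..<m} \<rightarrow>\<^sub>E {t. even t \<and> 0 \<le> t \<and> t < R}"
      using p k R by (auto simp: PiE_iff extensional_def)
    ultimately show "\<sigma> z \<in> top_simplices m R"
      using pi unfolding \<sigma>z top_simplices_def by simp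
    have "((p k + 2 * s k) mod R - 2 * s k) mod R = p k"
      using pk by (simp add: mod_diff_left_eq)
    then show "\<sigma> (\<sigma> z) = z"
      unfolding \<sigma>z by (auto simp: \<sigma>_def k_def[symmetric])
    define q where "q = (p k + 2 * s k) div R"
    have q: "(p k + 2 * s k) mod R = p k + 2 * s k - q * R"
      by (simp add: q_def minus_div_mult_eq_mod)
    define v where "v = vertex (p, s, \<pi>)"
    have kin: "k \<in> \<pi> ` {..<j}" if "0 < j" for j
      using that by (auto simp: k_def)
    have v': "vertex (\<sigma> z) j = (v j)(k := v j k - q * R)" if "0 < j" for j
      using kin[OF that] unfolding \<sigma>z v_def q by (auto simp: vertex_def fun_eq_iff)
    have shift: "\<Psi> (\<lambda>j. (v j)(k := v j k - c * R)) = \<Psi> v" for c :: int and v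
    proof (induction c rule: int_induct[where k = 0])
      case base
      then show ?case by simp
    next
      case (step1 i)
      have "\<Psi> (\<lambda>j. (v j)(k := v j k - i * R)) = \<Psi> (\<lambda>j. (v j)(k := v j k - (i + 1) * R))"
        using per[unfolded periodic_def, rule_format, OF k, of "\<lambda>j. (v j)(k := v j k - (i + 1) * R)"]
        by (simp add: algebra_simps)
      with step1(2) show ?case by argo
    next
      case (step2 i)
      have "\<Psi> (\<lambda>j. (v j)(k := v j k - i * R)) = \<Psi> (\<lambda>j. (v j)(k := v j k - (i - 1) * R))"
        using per[unfolded periodic_def, rule_format, OF k, of "\<lambda>j. (v j)(k := v j k - i * R)"]
        by (simp add: algebra_simps)
      with step2(2) show ?case by argo
    qed
    have "\<Psi> (vertex (\<sigma> z)) = \<Psi> (\<lambda>j. (v j)(k := v j k - q * R))"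
      by (rule ind) (rule v')
    also have "\<dots> = \<Psi> (vertex z)"
      unfolding shift by (simp add: v_def)
    finally have "\<Psi> (vertex (\<sigma> z)) = \<Psi> (vertex z)" .
    moreover have "orientation m (\<sigma> z) = - orientation m z"
      unfolding \<sigma>z unfolding orientation_def zz prod.case prod_upd_uminus[OF k] by simp
    ultimately show "orientation m (\<sigma> z) * \<Psi> (vertex (\<sigma> z)) = - (orientation m z * \<Psi> (vertex z))"
      by simp
  qed
qed

text \<open>A multivalued potential on the torus, lifted to the lattice: its increments are
  periodic, hence a 1-cocycle, and \<open>C k\<close> is the integral of that cocycle along the
  \<open>k\<close>-th circle.\<close>

definition qperiodic :: "nat \<Rightarrow> int \<Rightarrow> ((nat \<Rightarrow> int) \<Rightarrow> real) \<Rightarrow> (nat \<Rightarrow> real) \<Rightarrow> bool" where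
  "qperiodic m R F C \<longleftrightarrow> (\<forall>x k. k < m \<longrightarrow> F (x(k := x k + R)) = F x + C k)"

text \<open>For both this lemma and the next, write a difference of consecutive values of \<open>F\<close> as a difference skipping a vertex
plus a term that shifts the hole by one.\<close>

lemma cycle_sum_zero_up:
  assumes R: "even R" "0 < R" and F: "\<And>l. l < m \<Longrightarrow> qperiodic m R (F l) (C l)"
  shows "i < m \<Longrightarrow> (\<And>v w. (\<And>j. i < j \<Longrightarrow> v j = w j) \<Longrightarrow> \<Omega> v = \<Omega> w) \<Longrightarrow> periodic m R \<Omega> \<Longrightarrow>
    cycle_sum m R (\<lambda>v. (\<Prod>l<i. F l (v (Suc l)) - F l (v l)) * \<Omega> v) = 0"
proof (induction i arbitrary: \<Omega>)
  case 0
  have "cycle_sum m R \<Omega> = 0"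
    by (rule cycle_sum_zero_bottom[OF _ R]) (fact 0)+
  then show ?case by simp
next
  case (Suc i)
  let ?P = "\<lambda>v. (\<Prod>l<i. F l (v (Suc l)) - F l (v l))"
  define A where "A = (\<lambda>v. ?P v * ((F i (v (Suc (Suc i))) - F i (v i)) * \<Omega> v))"
  define B where "B = (\<lambda>v. (F i (v (Suc (Suc i))) - F i (v (Suc i))) * \<Omega> v)"
  have "cycle_sum m R A = 0"
  proof (rule cycle_sum_zero_interior[of "Suc i"])
    fix v w :: "nat \<Rightarrow> nat \<Rightarrow> int" assume vw: "\<And>j. j \<noteq> Suc i \<Longrightarrow> v j = w j"
    then have "\<Omega> v = \<Omega> w" by (intro Suc.prems(2)) auto
    moreover have "?P v = ?P w" by (rule prod.cong) (auto simp: vw)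
    ultimately show "A v = A w" by (simp add: A_def vw)
  qed (use Suc.prems(1) in auto)
  moreover have "cycle_sum m R (\<lambda>v. ?P v * B v) = 0"
  proof (rule Suc.IH)
    fix v w :: "nat \<Rightarrow> nat \<Rightarrow> int" assume vw: "\<And>j. i < j \<Longrightarrow> v j = w j"
    then have "\<Omega> v = \<Omega> w" by (intro Suc.prems(2)) auto
    then show "B v = B w" by (simp add: B_def vw)
  next
    show "periodic m R B"
      using Suc.prems(1,3) F[of i] by (auto simp: periodic_def B_def qperiodic_def)
  qed (use Suc.prems(1) in auto)
  moreover have "(\<lambda>v. (\<Prod>l<Suc i. F l (v (Suc l)) - F l (v l)) * \<Omega> v) = (\<lambda>v. A v - ?P v * B v)"
    by (auto simp: A_def B_def algebra_simps fun_eq_iff)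
  ultimately show ?case by (simp add: cycle_sum_diff)
qed

lemma cycle_sum_zero_down:
  "i + d + 1 = m \<Longrightarrow> (\<And>v w. (\<And>j. j \<le> i \<Longrightarrow> v j = w j) \<Longrightarrow> \<Omega> v = \<Omega> w) \<Longrightarrow>
    cycle_sum m R (\<lambda>v. \<Omega> v * (\<Prod>l\<in>{Suc i..<m}. F l (v (Suc l)) - F l (v l))) = 0"
proof (induction d arbitrary: i \<Omega>)
  case 0
  have "cycle_sum m R \<Omega> = 0"
  proof (rule cycle_sum_zero_top)
    fix v w :: "nat \<Rightarrow> nat \<Rightarrow> int" assume "\<And>j. j < m \<Longrightarrow> v j = w j"
    with 0(1) show "\<Omega> v = \<Omega> w" by (intro 0(2)) auto
  qed (use 0(1) in auto)
  moreover have "{Suc i..<m} = {}" using 0(1) by simp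
  ultimately show ?case by simp
next
  case (Suc d)
  let ?P = "\<lambda>v. (\<Prod>l\<in>{Suc (Suc i)..<m}. F l (v (Suc l)) - F l (v l))"
  define A where "A = (\<lambda>v. \<Omega> v * (F (Suc i) (v (Suc (Suc i))) - F (Suc i) (v i)) * ?P v)"
  define B where "B = (\<lambda>v. \<Omega> v * (F (Suc i) (v (Suc i)) - F (Suc i) (v i)))"
  have "cycle_sum m R A = 0"
  proof (rule cycle_sum_zero_interior[of "Suc i"])
    fix v w :: "nat \<Rightarrow> nat \<Rightarrow> int" assume vw: "\<And>j. j \<noteq> Suc i \<Longrightarrow> v j = w j"
    then have "\<Omega> v = \<Omega> w" by (intro Suc.prems(2)) auto
    moreover have "?P v = ?P w" by (rule prod.cong) (auto simp: vw)
    ultimately show "A v = A w" by (simp add: A_def vw)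
  qed (use Suc.prems(1) in auto)
  moreover have "cycle_sum m R (\<lambda>v. B v * ?P v) = 0"
  proof (rule Suc.IH)
    fix v w :: "nat \<Rightarrow> nat \<Rightarrow> int" assume vw: "\<And>j. j \<le> Suc i \<Longrightarrow> v j = w j"
    then have "\<Omega> v = \<Omega> w" by (intro Suc.prems(2)) auto
    then show "B v = B w" by (simp add: B_def vw)
  qed (use Suc.prems(1) in auto)
  moreover have "(\<Prod>l\<in>{Suc i..<m}. F l (v (Suc l)) - F l (v l))
      = (F (Suc i) (v (Suc (Suc i))) - F (Suc i) (v (Suc i))) * ?P v" for v
    using Suc.prems(1) by (subst prod.atLeast_Suc_lessThan) auto
  then have "(\<lambda>v. \<Omega> v * (\<Prod>l\<in>{Suc i..<m}. F l (v (Suc l)) - F l (v l))) = (\<lambda>v. A v - B v * ?P v)"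
    by (simp add: A_def B_def) (simp add: algebra_simps fun_eq_iff)
  ultimately show ?case by (simp add: cycle_sum_diff)
qed

text \<open>With \<open>C i = 0\<close> factor \<open>i\<close> is the coboundary of a genuine
  function on the torus, and its two terms vanish separately: the term at vertex
  \<open>Suc i\<close> by \<open>cycle_sum_zero_up\<close>, whose periodicity condition is what
  \<open>C i = 0\<close> supplies, and the term at vertex \<open>i\<close> by
  \<open>cycle_sum_zero_down\<close>.\<close>

lemma cycle_sum_zero_coboundary:
  assumes R: "even R" "0 < R" and F: "\<And>l. l < m \<Longrightarrow> qperiodic m R (F l) (C l)"
    and i: "i < m" "C i = (\<lambda>_. 0)"
  shows "cycle_sum m R (\<lambda>v. \<Prod>l<m. F l (v (Suc l)) - F l (v l)) = 0"
proof -
  let ?P = "\<lambda>v. (\<Prod>l<i. F l (v (Suc l)) - F l (v l))"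
  let ?Q = "\<lambda>v. (\<Prod>l\<in>{Suc i..<m}. F l (v (Suc l)) - F l (v l))"
  have "cycle_sum m R (\<lambda>v. ?P v * (F i (v (Suc i)) * ?Q v)) = 0"
  proof (rule cycle_sum_zero_up[OF R F])
    show "periodic m R (\<lambda>v. F i (v (Suc i)) * ?Q v)"
      using F i unfolding periodic_def
      by (intro allI impI arg_cong2[where f = "(*)"] prod.cong) (auto simp: qperiodic_def)
    show "F i (v (Suc i)) * ?Q v = F i (w (Suc i)) * ?Q w" if "\<And>j. i < j \<Longrightarrow> v j = w j" for v w
      by (intro arg_cong2[where f = "(*)"] prod.cong) (auto simp: that)
  qed (use i in simp_all)
  moreover have "cycle_sum m R (\<lambda>v. (?P v * F i (v i)) * ?Q v) = 0"
  proof (rule cycle_sum_zero_down[where d = "m - i - 1"])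
    show "?P v * F i (v i) = ?P w * F i (w i)" if "\<And>j. j \<le> i \<Longrightarrow> v j = w j" for v w
      by (intro arg_cong2[where f = "(*)"] prod.cong) (auto simp: that)
  qed (use i in simp)
  moreover have "(\<Prod>l<m. F l (v (Suc l)) - F l (v l)) = ?P v * (F i (v (Suc i)) - F i (v i)) * ?Q v" for v
  proof -
    have "{..<m} = {..<i} \<union> insert i {Suc i..<m}" using i by auto
    then show ?thesis by (simp add: prod.union_disjoint Int_Un_distrib disjoint_iff)
  qed
  then have "(\<lambda>v. \<Prod>l<m. F l (v (Suc l)) - F l (v l)) =
      (\<lambda>v. ?P v * (F i (v (Suc i)) * ?Q v) - (?P v * F i (v i)) * ?Q v)"
    by (simp add: algebra_simps fun_eq_iff)
  ultimately show ?thesis by (simp add: cycle_sum_diff)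
qed

section \<open>Evaluation of cup products as determinants of periods\<close>

definition leibniz_det :: "nat \<Rightarrow> (nat \<Rightarrow> nat \<Rightarrow> real) \<Rightarrow> real" where
  "leibniz_det m C = (\<Sum>\<pi> | \<pi> permutes {..<m}. of_int (sign \<pi>) * (\<Prod>l<m. C l (\<pi> l)))"

definition linear_form :: "nat \<Rightarrow> int \<Rightarrow> (nat \<Rightarrow> real) \<Rightarrow> (nat \<Rightarrow> int) \<Rightarrow> real" where
  "linear_form m R C x = (\<Sum>k<m. C k * of_int (x k) / of_int R)"

lemma linear_form_upd: "k < m \<Longrightarrow> linear_form m R C (x(k := x k + t)) = linear_form m R C x + C k * of_int t / of_int R"
  unfolding linear_form_def by (simp add: sum.remove[of "{..<m}" k] algebra_simps add_divide_distrib)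

lemma qperiodic_linear_form: "0 < R \<Longrightarrow> qperiodic m R (linear_form m R C) C"
  by (auto simp: qperiodic_def linear_form_upd)

lemma vertex_Suc:
  assumes "(p, s, \<pi>) \<in> top_simplices m R" "l < m"
  shows "vertex (p, s, \<pi>) (Suc l) = (vertex (p, s, \<pi>) l)(\<pi> l := vertex (p, s, \<pi>) l (\<pi> l) + s (\<pi> l))"
    and "vertex (p, s, \<pi>) l (\<pi> l) = p (\<pi> l)"
proof -
  have "\<pi> permutes {..<m}"
    using assms(1) by (simp add: top_simplices_def)
  then have notin: "\<pi> l \<notin> \<pi> ` {..<l}"
    by (simp add: inj_image_mem_iff[OF permutes_inj])
  then show l: "vertex (p, s, \<pi>) l (\<pi> l) = p (\<pi> l)"
    by (simp add: vertex_def)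
  show "vertex (p, s, \<pi>) (Suc l) = (vertex (p, s, \<pi>) l)(\<pi> l := vertex (p, s, \<pi>) l (\<pi> l) + s (\<pi> l))"
    unfolding l using notin by (simp add: vertex_def fun_eq_iff lessThan_Suc)
qed

lemma card_even: "card {t::int. even t \<and> 0 \<le> t \<and> t < 2 * int Q} = Q"
proof -
  have "{t::int. even t \<and> 0 \<le> t \<and> t < 2 * int Q} = (\<lambda>k. 2 * k) ` {0..<int Q}"
    by (auto elim!: evenE)
  then show ?thesis by (simp add: card_image inj_on_def)
qed

text \<open>The signs of the moves cancel those in \<open>orientation\<close>, so a simplex
  contributes a term of the determinant divided by \<open>R^m\<close>, whatever its start and its
  signs. There are \<open>(R/2)^m\<close> starts and \<open>2^m\<close> sign vectors.\<close>

lemma cycle_sum_linear_form: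
  assumes R: "even R" "0 < R"
  shows "cycle_sum m R (\<lambda>v. \<Prod>l<m. linear_form m R (C l) (v (Suc l)) - linear_form m R (C l) (v l)) = leibniz_det m C"
proof -
  obtain Q where Q: "R = 2 * int Q" "Q > 0"
    using R by (auto simp: dvd_def intro: that[of "nat (R div 2)"])
  have *: "orientation m z * (\<Prod>l<m. linear_form m R (C l) (vertex z (Suc l)) - linear_form m R (C l) (vertex z l))
     = (case z of (p, s, \<pi>) \<Rightarrow> of_int (sign \<pi>) * (\<Prod>l<m. C l (\<pi> l)) / of_int R ^ m)"
    if z: "z \<in> top_simplices m R" for z
  proof -
    obtain p s \<pi> where zz: "z = (p, s, \<pi>)" by (cases z)
    have pi: "\<pi> permutes {..<m}" and s: "s \<in> {..<m} \<rightarrow>\<^sub>E {-1, 1}"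
      using z by (auto simp: zz top_simplices_def)
    have "(\<Prod>l<m. linear_form m R (C l) (vertex z (Suc l)) - linear_form m R (C l) (vertex z l))
        = (\<Prod>l<m. C l (\<pi> l) * of_int (s (\<pi> l)) / of_int R)"
    proof (rule prod.cong)
      fix l assume "l \<in> {..<m}"
      then have l: "l < m" "\<pi> l < m" using permutes_in_image[OF pi, of l] by auto
      show "linear_form m R (C l) (vertex z (Suc l)) - linear_form m R (C l) (vertex z l) = C l (\<pi> l) * of_int (s (\<pi> l)) / of_int R"
        unfolding zz by (subst vertex_Suc(1)[OF z[unfolded zz] l(1)]) (simp add: linear_form_upd l)
    qed simp
    also have "\<dots> = (\<Prod>l<m. C l (\<pi> l)) * (\<Prod>l<m. of_int (s (\<pi> l))) / of_int R ^ m"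
      by (simp add: prod_dividef prod.distrib)
    also have "(\<Prod>l<m. real_of_int (s (\<pi> l))) = (\<Prod>l<m. real_of_int (s l))"
      by (rule prod.permute[OF pi, of "\<lambda>l. real_of_int (s l)", unfolded o_def, symmetric])
    finally have "(\<Prod>l<m. linear_form m R (C l) (vertex z (Suc l)) - linear_form m R (C l) (vertex z l)) =
       (\<Prod>l<m. C l (\<pi> l)) * (\<Prod>l<m. real_of_int (s l)) / of_int R ^ m" .
    moreover have "(\<Prod>l<m. real_of_int (s l)) * (\<Prod>l<m. real_of_int (s l)) = 1"
      unfolding prod.distrib[symmetric]
    proof (intro prod.neutral ballI)
      fix l assume "l \<in> {..<m}"
      then have "s l \<in> {-1, 1}" using s by (auto simp: PiE_iff)
      then show "real_of_int (s l) * real_of_int (s l) = 1" by auto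
    qed
    moreover have "a * S * (P * S / r) = a * P / r" if "S * S = 1" for a S P r :: real
    proof -
      have "a * S * (P * S / r) = a * P / r * (S * S)" by simp
      then show ?thesis using that by simp
    qed
    ultimately show ?thesis
      unfolding zz orientation_def prod.case by simp
  qed
  have "cycle_sum m R (\<lambda>v. \<Prod>l<m. linear_form m R (C l) (v (Suc l)) - linear_form m R (C l) (v l))
      = (\<Sum>z\<in>top_simplices m R. (case z of (p, s, \<pi>) \<Rightarrow> of_int (sign \<pi>) * (\<Prod>l<m. C l (\<pi> l)) / of_int R ^ m))"
    unfolding cycle_sum_def by (rule sum.cong[OF refl *])
  also have "\<dots> = real (card ({..<m} \<rightarrow>\<^sub>E {t::int. even t \<and> 0 \<le> t \<and> t < R})) *
      (real (card ({..<m} \<rightarrow>\<^sub>E {-1, 1::int})) * (leibniz_det m C / of_int R ^ m))"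
    unfolding top_simplices_def by (simp add: sum.cartesian_product[symmetric] leibniz_det_def sum_divide_distrib)
  also have "\<dots> = real Q ^ m * 2 ^ m / of_int R ^ m * leibniz_det m C"
    using Q(2) by (simp add: card_PiE card_even Q(1))
  also have "real Q ^ m * 2 ^ m / of_int R ^ m = 1"
    using Q by (simp add: power_mult_distrib)
  finally show ?thesis by simp
qed

text \<open>Replacing each \<open>F l\<close> by its linear part changes it by a periodic function, that is, the cocycle by a coboundary.\<close>

lemma cycle_sum_det:
  assumes R: "even R" "0 < R" and F: "\<And>l. l < m \<Longrightarrow> qperiodic m R (F l) (C l)"
  shows "cycle_sum m R (\<lambda>v. \<Prod>l<m. F l (v (Suc l)) - F l (v l)) = leibniz_det m C"
proof -
  define G where "G j l = (if l < j then linear_form m R (C l) else F l)" for j l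
  have G: "qperiodic m R (G j l) (C l)" if "l < m" for j l
    using that F R qperiodic_linear_form by (simp add: G_def)
  define c where "c G = cycle_sum m R (\<lambda>v. \<Prod>l<m. G l (v (Suc l)) - G l (v l))" for G
  have "c (G j) = c (G 0)" if "j \<le> m" for j
    using that
  proof (induction j)
    case (Suc j)
    \<comment> \<open>Factor \<open>j\<close> becomes the difference of two potentials with the same
      periods, hence a periodic function.\<close>
    define H where "H l x = (if l = j then F l x - linear_form m R (C l) x else G j l x)" for l x
    have "c H = 0"
    unfolding c_def
    proof (rule cycle_sum_zero_coboundary[OF R, where i = j and C = "\<lambda>l. if l = j then (\<lambda>_. 0) else C l"])
      fix l assume l: "l < m"
      show "qperiodic m R (H l) (if l = j then (\<lambda>_. 0) else C l)"
        using G[OF l, of j] F[OF l] qperiodic_linear_form[of R m "C l"] R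
        by (auto simp: qperiodic_def H_def)
    qed (use Suc in auto)
    have "(\<Prod>l<m. G j l (v (Suc l)) - G j l (v l)) =
        (\<Prod>l<m. G (Suc j) l (v (Suc l)) - G (Suc j) l (v l)) + (\<Prod>l<m. H l (v (Suc l)) - H l (v l))" for v
    proof -
      have "(\<Prod>l\<in>{..<m}-{j}. G j l (v (Suc l)) - G j l (v l)) = (\<Prod>l\<in>{..<m}-{j}. G (Suc j) l (v (Suc l)) - G (Suc j) l (v l))"
        "(\<Prod>l\<in>{..<m}-{j}. G j l (v (Suc l)) - G j l (v l)) = (\<Prod>l\<in>{..<m}-{j}. H l (v (Suc l)) - H l (v l))"
        by (rule prod.cong; auto simp: G_def H_def less_Suc_eq)+
      then show ?thesis
        using Suc.prems by (simp add: prod.remove[of "{..<m}" j]) (simp add: G_def H_def left_diff_distrib)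
    qed
    then have "c (G j) = c (G (Suc j)) + c H"
      unfolding c_def cycle_sum_add[symmetric] by (rule arg_cong[where f = "cycle_sum m R", OF ext])
    moreover have "c (G j) = c (G 0)" by (rule Suc.IH) (use Suc.prems in simp)
    ultimately show ?case using \<open>c H = 0\<close> by linarith
  qed simp
  from this[of m] have "c (G m) = c (G 0)" by simp
  moreover have "G 0 = F" by (simp add: G_def fun_eq_iff)
  ultimately have "c F = c (G m)" by (simp only:)
  also have "\<dots> = c (\<lambda>l. linear_form m R (C l))"
    unfolding c_def cycle_sum_def by (intro sum.cong arg_cong2[where f = "(*)"] prod.cong) (auto simp: G_def)
  also have "\<dots> = leibniz_det m C"
    unfolding c_def by (rule cycle_sum_linear_form[OF R])
  finally show ?thesis
    unfolding c_def .
qed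

section \<open>Monotone labellings of the grid and their cocycles\<close>

lemma int_antidifference:
  "\<exists>S :: (int \<Rightarrow> real) \<Rightarrow> int \<Rightarrow> real. \<forall>f. S f 0 = 0 \<and> (\<forall>t. S f (t + 1) - S f t = f t)"
proof -
  define S :: "(int \<Rightarrow> real) \<Rightarrow> int \<Rightarrow> real" where
    "S f t = (if t \<ge> 0 then \<Sum>k<nat t. f (int k) else - (\<Sum>k<nat (- t). f (- 1 - int k)))" for f t
  have "S f 0 = 0" for f
    by (simp add: S_def)
  moreover have "S f (t + 1) - S f t = f t" for f t
  proof (cases "t \<ge> 0")
    case True
    then have "nat (t + 1) = Suc (nat t)" by simp
    with True show ?thesis by (simp add: S_def)
  next
    case False
    then have "nat (- t) = Suc (nat (- (t + 1)))" by simp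
    moreover have "- 1 - int (nat (- (t + 1))) = t" using False by simp
    ultimately have "(\<Sum>k<nat (- t). f (- 1 - int k)) = (\<Sum>k<nat (- (t + 1)). f (- 1 - int k)) + f t"
      by simp
    then show ?thesis using False by (auto simp: S_def)
  qed
  ultimately show ?thesis by blast
qed

lemma int_diff_eqI:
  fixes A B :: "int \<Rightarrow> real"
  assumes "\<And>t. A (t + 1) - A t = B (t + 1) - B t"
  shows "A t - A 0 = B t - B 0"
proof (induction t rule: int_induct[where k = 0])
  case (step1 i)
  with assms[of i] show ?case by simp
next
  case (step2 i)
  with assms[of "i - 1"] show ?case by simp
qed simp

lemma sum_int_telescope:
  fixes f :: "int \<Rightarrow> real"
  assumes "0 \<le> R"
  shows "(\<Sum>t\<in>{0..<R}. f (t + 1) - f t) = f R - f 0"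
  using assms
proof (induction R rule: int_ge_induct)
  case (step i)
  then have "{0..<i + 1} = insert i {0..<i}" by auto
  with step show ?case by simp
qed simp

text \<open>The potential of the first \<open>m\<close> directions is kept on the hyperplane
  \<open>x m = 0\<close> and \<open>\<eta> m\<close> is integrated away from it. By closedness, a
  step in direction \<open>k\<close> changes this integral by the increment of
  \<open>\<eta> k\<close> along direction \<open>m\<close>, which corrects the value of
  \<open>\<eta> k\<close> from the hyperplane to \<open>x\<close>.\<close>

lemma discrete_poincare:
  fixes \<eta> :: "nat \<Rightarrow> (nat \<Rightarrow> int) \<Rightarrow> real"
  assumes "\<And>k l x. k < m \<Longrightarrow> l < m \<Longrightarrow> k \<noteq> l \<Longrightarrow>
    \<eta> k x + \<eta> l (x(k := x k + 1)) = \<eta> l x + \<eta> k (x(l := x l + 1))"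
  shows "\<exists>F. \<forall>k<m. \<forall>x. F (x(k := x k + 1)) - F x = \<eta> k x"
  using assms
proof (induction m)
  case (Suc m)
  have "\<exists>F. \<forall>k<m. \<forall>x. F (x(k := x k + 1)) - F x = \<eta> k x"
    by (rule Suc.IH) (rule Suc.prems; simp)
  then obtain F where F: "\<And>k x. k < m \<Longrightarrow> F (x(k := x k + 1)) - F x = \<eta> k x" by blast
  obtain S :: "(int \<Rightarrow> real) \<Rightarrow> int \<Rightarrow> real"
    where S: "\<And>f. S f 0 = 0" "\<And>f t. S f (t + 1) - S f t = f t"
    using int_antidifference by blast
  define H where "H x = F (x(m := 0)) + S (\<lambda>t. \<eta> m (x(m := t))) (x m)" for x
  have "H (x(k := x k + 1)) - H x = \<eta> k x" if k: "k < Suc m" for k x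
  proof (cases "k = m")
    case True
    then show ?thesis using S(2)[of "\<lambda>t. \<eta> m (x(m := t))" "x m"] by (simp add: H_def)
  next
    case False
    with k have km: "k < m" by simp
    let ?f = "\<lambda>t. \<eta> m (x(m := t))" and ?f' = "\<lambda>t. \<eta> m (x(k := x k + 1, m := t))"
    have sw: "x(k := x k + 1, m := t) = x(m := t, k := x k + 1)" for t
      using False by (auto simp: fun_eq_iff)
    have "\<eta> k (x(m := t)) + ?f' t = ?f t + \<eta> k (x(m := t + 1))" for t
    proof -
      have "(x(m := t)) k = x k" "(x(m := t)) m = t" using False by simp_all
      with Suc.prems[of k m "x(m := t)"] km show ?thesis
        unfolding sw by (simp del: fun_upd_apply)
    qed
    then have "(S ?f' (t + 1) - S ?f (t + 1)) - (S ?f' t - S ?f t) = \<eta> k (x(m := t + 1)) - \<eta> k (x(m := t))" for t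
      using S(2)[of ?f t] S(2)[of ?f' t] by (smt (verit))
    from int_diff_eqI[of "\<lambda>t. S ?f' t - S ?f t" "\<lambda>t. \<eta> k (x(m := t))", OF this]
    have "S ?f' (x m) - S ?f (x m) = \<eta> k x - \<eta> k (x(m := 0))"
      using S(1) by simp
    moreover have "F (x(k := x k + 1, m := 0)) - F (x(m := 0)) = \<eta> k (x(m := 0))"
      using F[OF km, of "x(m := 0)"] False unfolding sw by simp
    ultimately show ?thesis
      using False by (simp add: H_def)
  qed
  then show ?case by blast
qed simp

section \<open>Labels on a torus and the cocycles pulled back by them\<close>

definition restrict_coords :: "nat \<Rightarrow> (nat \<Rightarrow> int) \<Rightarrow> nat \<Rightarrow> int" where
  "restrict_coords m x = (\<lambda>c. if c < m then x c else 0)"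

lemma restrict_coords_upd: "k < m \<Longrightarrow> restrict_coords m (x(k := t)) = (restrict_coords m x)(k := t)"
  by (auto simp: restrict_coords_def fun_eq_iff)

text \<open>\<open>G x\<close> is a vertex or an edge of a graph, and it shrinks as the cube encoded by \<open>x\<close> grows.\<close>

definition torus_map :: "nat \<Rightarrow> int \<Rightarrow> ((nat \<Rightarrow> int) \<Rightarrow> 'v set) \<Rightarrow> bool" where
  "torus_map m R G \<longleftrightarrow>
     (\<forall>x. card (G x) = 1 \<or> card (G x) = 2) \<and>
     (\<forall>x. G (restrict_coords m x) = G x) \<and>
     (\<forall>x k. k < m \<longrightarrow> G (x(k := x k + R)) = G x) \<and>
     (\<forall>x k s. k < m \<longrightarrow> even (x k) \<longrightarrow> s = 1 \<or> s = -1 \<longrightarrow> G (x(k := x k + s)) \<subseteq> G x)"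

text \<open>The signed 1-cochain that detects a step from the edge \<open>e\<close> to its end point \<open>a\<close>.\<close>

definition drop_sign :: "'v set \<Rightarrow> 'v set \<Rightarrow> 'v set \<Rightarrow> 'v set \<Rightarrow> real" where
  "drop_sign e a S T = of_bool (S = e \<and> T = a) - of_bool (T = e \<and> S = a)"

lemma drop_sign_swap: "drop_sign e a T S = - drop_sign e a S T"
  by (simp add: drop_sign_def)

text \<open>Sizes 1 and 2 leave room for at most one strict inclusion, and an equality contributes 0
  because \<open>e\<close> and \<open>a\<close> differ in size. This is the cocycle condition on
  flags.\<close>

lemma drop_sign_chain:
  assumes "card e = 2" "card a = 1" "T \<subseteq> S" "U \<subseteq> T"
    and "card S = 1 \<or> card S = 2" "card T = 1 \<or> card T = 2" "card U = 1 \<or> card U = 2"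
  shows "drop_sign e a S T + drop_sign e a T U = drop_sign e a S U"
proof -
  have fin: "finite S" "finite T"
    using assms(5,6) by (metis card.infinite zero_neq_one zero_neq_numeral)+
  then have "card T \<le> card S" "card U \<le> card T"
    using assms(3,4) by (simp_all add: card_mono)
  then have "card T = card S \<or> card U = card T"
    using assms(5,6,7) by linarith
  then have TU: "T = S \<or> U = T"
    using card_subset_eq[OF fin(1) assms(3)] card_subset_eq[OF fin(2) assms(4)] by blast
  have "e \<noteq> a" using assms(1,2) by auto
  then have "drop_sign e a X X = 0" for X
    by (auto simp: drop_sign_def)
  with TU show ?thesis by auto
qed

lemma torus_map_edge:
  fixes x :: "nat \<Rightarrow> int"
  assumes "torus_map m R G" "k < m"
  shows "even (x k) \<Longrightarrow> G (x(k := x k + 1)) \<subseteq> G x"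
    and "odd (x k) \<Longrightarrow> G x \<subseteq> G (x(k := x k + 1))"
proof -
  have *: "even (x k) \<Longrightarrow> s = 1 \<or> s = -1 \<Longrightarrow> G (x(k := x k + s)) \<subseteq> G x" for x :: "nat \<Rightarrow> int" and s
    using assms unfolding torus_map_def by blast
  show "even (x k) \<Longrightarrow> G (x(k := x k + 1)) \<subseteq> G x"
    using * by blast
  show "odd (x k) \<Longrightarrow> G x \<subseteq> G (x(k := x k + 1))"
    using *[of "x(k := x k + 1)" "-1"] by simp
qed

text \<open>In every lattice square, two opposite corners have nested labels, with the labels of
  both other corners in between; the parities decide which two. So \<open>drop_sign_chain\<close>
  makes the increments closed. As they are also periodic, the gain of the potential over one period
  is constant and can be computed on the axis through the origin.\<close>

lemma torus_potential:
  assumes G: "torus_map m R G" and R: "0 < R" and ea: "card e = 2" "card a = 1"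
  obtains F where
    "\<And>x k. k < m \<Longrightarrow> F (x(k := x k + 1)) - F x = drop_sign e a (G x) (G (x(k := x k + 1)))"
    "qperiodic m R F
      (\<lambda>k. \<Sum>t\<in>{0..<R}. drop_sign e a (G ((\<lambda>_. 0)(k := t))) (G ((\<lambda>_. 0)(k := t + 1))))"
proof -
  let ?D = "drop_sign e a"
  define \<eta> where "\<eta> k x = ?D (G x) (G (x(k := x k + 1)))" for k and x :: "nat \<Rightarrow> int"
  have card: "card (G x) = 1 \<or> card (G x) = 2" for x
    using G unfolding torus_map_def by blast
  have chain: "T \<subseteq> P \<Longrightarrow> P \<subseteq> B \<Longrightarrow> B \<in> range G \<Longrightarrow> P \<in> range G \<Longrightarrow> T \<in> range G \<Longrightarrow>
      ?D B P + ?D P T = ?D B T" for B P T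
    by (rule drop_sign_chain[OF ea]) (use card in blast)+
  have "\<exists>F. \<forall>k<m. \<forall>x. F (x(k := x k + 1)) - F x = \<eta> k x"
  proof (rule discrete_poincare)
    fix k l and x :: "nat \<Rightarrow> int" assume k: "k < m" and l: "l < m" and kl: "k \<noteq> l"
    define y z w where "y = x(k := x k + 1)" and "z = x(l := x l + 1)"
      and "w = x(k := x k + 1, l := x l + 1)"
    have w: "w = y(l := y l + 1)" "w = z(k := z k + 1)"
      using kl by (auto simp: w_def y_def z_def)
    note e = torus_map_edge[OF G k, of x] torus_map_edge[OF G l, of x]
      torus_map_edge[OF G l, of y] torus_map_edge[OF G k, of z]
    have par: "even (y l) = even (x l)" "even (z k) = even (x k)"
      using kl by (auto simp: y_def z_def)
    have e': "even (x k) \<Longrightarrow> G y \<subseteq> G x" "odd (x k) \<Longrightarrow> G x \<subseteq> G y"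
      "even (x l) \<Longrightarrow> G z \<subseteq> G x" "odd (x l) \<Longrightarrow> G x \<subseteq> G z"
      "even (x l) \<Longrightarrow> G w \<subseteq> G y" "odd (x l) \<Longrightarrow> G y \<subseteq> G w"
      "even (x k) \<Longrightarrow> G w \<subseteq> G z" "odd (x k) \<Longrightarrow> G z \<subseteq> G w"
      using e unfolding par by (simp_all add: y_def[symmetric] z_def[symmetric] w[symmetric])
    have "?D (G x) (G y) + ?D (G y) (G w) = ?D (G x) (G z) + ?D (G z) (G w)"
    proof (cases "even (x k)"; cases "even (x l)")
      assume "even (x k)" "even (x l)"
      with e' have "?D (G x) (G y) + ?D (G y) (G w) = ?D (G x) (G w)" "?D (G x) (G z) + ?D (G z) (G w) = ?D (G x) (G w)"
        by (auto intro!: chain)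
      then show ?thesis by simp
    next
      assume "odd (x k)" "even (x l)"
      with e' have "?D (G y) (G x) + ?D (G x) (G z) = ?D (G y) (G z)" "?D (G y) (G w) + ?D (G w) (G z) = ?D (G y) (G z)"
        by (auto intro!: chain)
      then show ?thesis using drop_sign_swap[of e a "G x" "G y"] drop_sign_swap[of e a "G z" "G w"] by linarith
    next
      assume "even (x k)" "odd (x l)"
      with e' have "?D (G z) (G x) + ?D (G x) (G y) = ?D (G z) (G y)" "?D (G z) (G w) + ?D (G w) (G y) = ?D (G z) (G y)"
        by (auto intro!: chain)
      then show ?thesis using drop_sign_swap[of e a "G x" "G z"] drop_sign_swap[of e a "G y" "G w"] by linarith
    next
      assume "odd (x k)" "odd (x l)"
      with e' have "?D (G w) (G y) + ?D (G y) (G x) = ?D (G w) (G x)" "?D (G w) (G z) + ?D (G z) (G x) = ?D (G w) (G x)"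
        by (auto intro!: chain)
      then show ?thesis using drop_sign_swap[of e a "G w" "G z"] drop_sign_swap[of e a "G w" "G y"]
          drop_sign_swap[of e a "G x" "G z"] drop_sign_swap[of e a "G x" "G y"] by linarith
    qed
    then show "\<eta> k x + \<eta> l (x(k := x k + 1)) = \<eta> l x + \<eta> k (x(l := x l + 1))"
      unfolding \<eta>_def y_def[symmetric] z_def[symmetric] w[symmetric] .
  qed
  then obtain F0 where F0: "\<And>k x. k < m \<Longrightarrow> F0 (x(k := x k + 1)) - F0 x = \<eta> k x" by blast
  \<comment> \<open>\<open>F0\<close> is not controlled in the coordinates from \<open>m\<close> on;
    freezing them at 0 makes the gain over a period the same at all lattice points.\<close>
  define F where "F x = F0 (restrict_coords m x)" for x
  have Gres: "G (restrict_coords m x) = G x" for x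
    using G unfolding torus_map_def by blast
  have Gper: "k < m \<Longrightarrow> G (x(k := x k + R)) = G x" for k x
    using G unfolding torus_map_def by blast
  have F: "F (x(k := x k + 1)) - F x = ?D (G x) (G (x(k := x k + 1)))" if "k < m" for x k
    using F0[OF that, of "restrict_coords m x"] that Gres[of x] Gres[of "x(k := x k + 1)"]
    unfolding F_def \<eta>_def restrict_coords_upd[OF that] by (simp add: restrict_coords_def)
  define P where "P k x = F (x(k := x k + R)) - F x" for k x
  have P1: "P k (x(l := x l + 1)) = P k x" if k: "k < m" and l: "l < m" for k l x
  proof -
    define u where "u = x(k := x k + R)"
    have u: "(x(l := x l + 1))(k := (x(l := x l + 1)) k + R) = u(l := u l + 1)"
      by (auto simp: u_def fun_eq_iff)
    have "G u = G x" unfolding u_def by (rule Gper[OF k])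
    moreover have "G (u(l := u l + 1)) = G (x(l := x l + 1))"
      unfolding u[symmetric] by (rule Gper[OF k])
    ultimately have "F (u(l := u l + 1)) - F u = F (x(l := x l + 1)) - F x"
      unfolding F[OF l] by simp
    then show ?thesis
      unfolding P_def u u_def[symmetric] by simp
  qed
  have P2: "P k (x(l := t)) = P k x" if k: "k < m" and l: "l < m" for k l x t
  proof -
    have "P k (x(l := t)) - P k (x(l := 0)) = 0 - 0" for t
    proof (rule int_diff_eqI[of "\<lambda>t. P k (x(l := t))" "\<lambda>_. 0"])
      show "P k (x(l := t + 1)) - P k (x(l := t)) = 0 - 0" for t
        using P1[OF k l, of "x(l := t)"] by simp
    qed
    from this[of t] this[of "x l"] show ?thesis by simp
  qed
  have P3: "P k x = P k (\<lambda>_. 0)" if k: "k < m" for k x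
  proof -
    have "j \<le> m \<Longrightarrow> P k (\<lambda>c. if c < j then 0 else x c) = P k x" for j
    proof (induction j)
      case (Suc j)
      have "(\<lambda>c. if c < Suc j then 0 else x c) = (\<lambda>c. if c < j then 0 else x c)(j := 0)"
        by (auto simp: fun_eq_iff)
      with Suc P2[OF k] show ?case by simp
    qed simp
    from this[of m] have "P k x = P k (\<lambda>c. if c < m then 0 else x c)" by simp
    also have "\<dots> = P k (\<lambda>_. 0)"
      using k unfolding P_def F_def restrict_coords_upd[OF k] by (simp add: restrict_coords_def if_distrib cong: if_cong)
    finally show ?thesis .
  qed
  have "P k (\<lambda>_. 0) = (\<Sum>t\<in>{0..<R}. ?D (G ((\<lambda>_. 0)(k := t))) (G ((\<lambda>_. 0)(k := t + 1))))" if k: "k < m" for k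
  proof -
    have "P k (\<lambda>_. 0) = F ((\<lambda>_. 0)(k := R)) - F ((\<lambda>_. 0)(k := 0))"
      by (simp add: P_def fun_upd_idem)
    also have "\<dots> = (\<Sum>t\<in>{0..<R}. F ((\<lambda>_. 0)(k := t + 1)) - F ((\<lambda>_. 0)(k := t)))"
      using sum_int_telescope[of R "\<lambda>t. F ((\<lambda>_. 0)(k := t))"] R by simp
    also have "\<dots> = (\<Sum>t\<in>{0..<R}. ?D (G ((\<lambda>_. 0)(k := t))) (G ((\<lambda>_. 0)(k := t + 1))))"
      using F[OF k, of "(\<lambda>_. 0)(k := t)" for t] by (intro sum.cong) simp_all
    finally show ?thesis .
  qed
  then have "P k x = (\<Sum>t\<in>{0..<R}. ?D (G ((\<lambda>_. 0)(k := t))) (G ((\<lambda>_. 0)(k := t + 1))))" if "k < m" for k x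
    using P3[OF that] that by simp
  then have "qperiodic m R F
      (\<lambda>k. \<Sum>t\<in>{0..<R}. ?D (G ((\<lambda>_. 0)(k := t))) (G ((\<lambda>_. 0)(k := t + 1))))"
    unfolding qperiodic_def P_def by (simp add: algebra_simps)
  with F show ?thesis by (rule that)
qed

lemma vertex_step:
  assumes G: "torus_map m R G" and z: "z \<in> top_simplices m R" and l: "l < m"
  shows "G (vertex z (Suc l)) \<subseteq> G (vertex z l)"
    and "(\<And>x k. k < m \<Longrightarrow> F (x(k := x k + 1)) - F x = drop_sign e a (G x) (G (x(k := x k + 1)))) \<Longrightarrow>
      F (vertex z (Suc l)) - F (vertex z l) = drop_sign e a (G (vertex z l)) (G (vertex z (Suc l)))"
proof -
  obtain p s \<pi> where zz: "z = (p, s, \<pi>)" by (cases z)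
  define k where "k = \<pi> l"
  have "\<pi> permutes {..<m}" using z by (simp add: zz top_simplices_def)
  then have k: "k < m" using l permutes_in_image[of \<pi> "{..<m}" l] by (simp add: k_def)
  have s: "s k = 1 \<or> s k = -1" and p: "even (p k)"
    using z k by (auto simp: zz top_simplices_def PiE_iff)
  have v: "vertex z (Suc l) = (vertex z l)(k := vertex z l k + s k)" and vk: "vertex z l k = p k"
    using vertex_Suc[OF z[unfolded zz] l] by (simp_all add: zz k_def)
  show "G (vertex z (Suc l)) \<subseteq> G (vertex z l)"
    unfolding v using G k s p vk unfolding torus_map_def by metis
  assume F: "\<And>x k. k < m \<Longrightarrow> F (x(k := x k + 1)) - F x = drop_sign e a (G x) (G (x(k := x k + 1)))"
  show "F (vertex z (Suc l)) - F (vertex z l) = drop_sign e a (G (vertex z l)) (G (vertex z (Suc l)))"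
    using s
  proof
    assume "s k = 1"
    then show ?thesis unfolding v using F[OF k] by simp
  next
    assume s1: "s k = -1"
    have "vertex z l = (vertex z (Suc l))(k := vertex z (Suc l) k + 1)"
      unfolding v s1 by simp
    then have "F (vertex z l) - F (vertex z (Suc l)) = drop_sign e a (G (vertex z (Suc l))) (G (vertex z l))"
      using F[OF k, of "vertex z (Suc l)"] by simp
    then show ?thesis
      using drop_sign_swap[of e a "G (vertex z (Suc l))" "G (vertex z l)"] by linarith
  qed
qed

text \<open>One entry of the period vector: the cocycle integrated along the \<open>c\<close>-th
  coordinate circle through the origin.\<close>

definition period :: "int \<Rightarrow> ((nat \<Rightarrow> int) \<Rightarrow> 'v set) \<Rightarrow> 'v set \<Rightarrow> 'v set \<Rightarrow> nat \<Rightarrow> real" where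
  "period R g e a c =
    (\<Sum>t\<in>{0..<R}. drop_sign e a (g ((\<lambda>_. 0)(c := t))) (g ((\<lambda>_. 0)(c := t + 1))))"

text \<open>Labels only shrink along a simplex, so the negative half of \<open>drop_sign\<close> is
  never met there: the indicator of the drop from \<open>e l\<close> to \<open>a l\<close> is the
  increment of a potential, and \<open>cycle_sum_det\<close> applies.\<close>

lemma cycle_sum_cup:
  assumes G: "\<And>l. l < m \<Longrightarrow> torus_map m R (G l)" and R: "even R" "0 < R"
    and ea: "\<And>l. l < m \<Longrightarrow> card (e l) = 2" "\<And>l. l < m \<Longrightarrow> card (a l) = 1"
  shows "cycle_sum m R (\<lambda>v. \<Prod>l<m. of_bool (G l (v l) = e l \<and> G l (v (Suc l)) = a l)) =
    leibniz_det m (\<lambda>l. period R (G l) (e l) (a l))"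
proof -
  have "\<forall>l. \<exists>F. l < m \<longrightarrow>
    (\<forall>x k. k < m \<longrightarrow> F (x(k := x k + 1)) - F x = drop_sign (e l) (a l) (G l x) (G l (x(k := x k + 1)))) \<and>
    qperiodic m R F (period R (G l) (e l) (a l))"
  proof
    fix l
    show "\<exists>F. l < m \<longrightarrow>
    (\<forall>x k. k < m \<longrightarrow> F (x(k := x k + 1)) - F x = drop_sign (e l) (a l) (G l x) (G l (x(k := x k + 1)))) \<and>
    qperiodic m R F (period R (G l) (e l) (a l))"
    proof (cases "l < m")
      case True
      show ?thesis
        by (rule torus_potential[OF G[OF True] R(2) ea(1)[OF True] ea(2)[OF True]])
           (auto simp: period_def[abs_def])
    qed simp
  qed
  then obtain F where F: "\<And>l x k. l < m \<Longrightarrow> k < m \<Longrightarrow>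
      F l (x(k := x k + 1)) - F l x = drop_sign (e l) (a l) (G l x) (G l (x(k := x k + 1)))"
    and q: "\<And>l. l < m \<Longrightarrow> qperiodic m R (F l) (period R (G l) (e l) (a l))"
    by metis
  have "cycle_sum m R (\<lambda>v. \<Prod>l<m. of_bool (G l (v l) = e l \<and> G l (v (Suc l)) = a l)) =
      cycle_sum m R (\<lambda>v. \<Prod>l<m. F l (v (Suc l)) - F l (v l))"
    unfolding cycle_sum_def
  proof (intro sum.cong arg_cong2[where f = "(*)"] prod.cong refl)
    fix z l assume z: "z \<in> top_simplices m R" and "l \<in> {..<m}"
    then have l: "l < m" by simp
    have "F l (vertex z (Suc l)) - F l (vertex z l) = drop_sign (e l) (a l) (G l (vertex z l)) (G l (vertex z (Suc l)))"
      using vertex_step(2)[OF G[OF l] z l] F[OF l] by blast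
    moreover have "\<not> (G l (vertex z (Suc l)) = e l \<and> G l (vertex z l) = a l)"
    proof
      assume "G l (vertex z (Suc l)) = e l \<and> G l (vertex z l) = a l"
      then have "e l \<subseteq> a l" using vertex_step(1)[OF G[OF l] z l] by simp
      moreover have "finite (a l)" using ea(2)[OF l] card_ge_0_finite[of "a l"] by simp
      ultimately have "card (e l) \<le> card (a l)" by (rule card_mono[rotated])
      then show False using ea[OF l] by simp
    qed
    ultimately show "of_bool (G l (vertex z l) = e l \<and> G l (vertex z (Suc l)) = a l) = F l (vertex z (Suc l)) - F l (vertex z l)"
      by (simp add: drop_sign_def)
  qed
  also have "\<dots> = leibniz_det m (\<lambda>l. period R (G l) (e l) (a l))"
    by (rule cycle_sum_det[OF R q])
  finally show ?thesis .
qed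

section \<open>The combinatorial obstruction\<close>

lemma leibniz_det_cong:
  assumes "\<And>l k. l < m \<Longrightarrow> k < m \<Longrightarrow> C l k = D l k"
  shows "leibniz_det m C = leibniz_det m D"
  unfolding leibniz_det_def
proof (intro sum.cong arg_cong2[where f = "(*)"] prod.cong refl)
  fix \<pi> l assume "\<pi> \<in> {\<pi>. \<pi> permutes {..<m}}" "l \<in> {..<m}"
  then show "C l (\<pi> l) = D l (\<pi> l)"
    using assms permutes_in_image[of \<pi> "{..<m}" l] by simp
qed

lemma leibniz_det_rows:
  assumes \<rho>: "\<rho> permutes {..<m}"
  shows "leibniz_det m (\<lambda>l k. c l * M (\<rho> l) k) = (\<Prod>l<m. c l) * of_int (sign \<rho>) * leibniz_det m M"
proof -
  have "leibniz_det m (\<lambda>l k. c l * M (\<rho> l) k) =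
      (\<Sum>\<pi> | \<pi> permutes {..<m}. of_int (sign (\<pi> \<circ> \<rho>)) * (\<Prod>l<m. c l * M (\<rho> l) ((\<pi> \<circ> \<rho>) l)))"
    unfolding leibniz_det_def by (rule sum_permutations_compose_right[OF \<rho>])
  also have "\<dots> = (\<Sum>\<pi> | \<pi> permutes {..<m}. (\<Prod>l<m. c l) * of_int (sign \<rho>) * (of_int (sign \<pi>) * (\<Prod>l<m. M l (\<pi> l))))"
  proof (rule sum.cong)
    fix \<pi> assume "\<pi> \<in> {\<pi>. \<pi> permutes {..<m}}"
    then have \<pi>: "permutation \<pi>" "permutation \<rho>"
      using \<rho> by (auto intro!: permutation_permutes[THEN iffD2])
    have "(\<Prod>l<m. M (\<rho> l) (\<pi> (\<rho> l))) = (\<Prod>l<m. M l (\<pi> l))"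
      by (rule prod.permute[OF \<rho>, of "\<lambda>l. M l (\<pi> l)", unfolded o_def, symmetric])
    then show "of_int (sign (\<pi> \<circ> \<rho>)) * (\<Prod>l<m. c l * M (\<rho> l) ((\<pi> \<circ> \<rho>) l)) =
        (\<Prod>l<m. c l) * of_int (sign \<rho>) * (of_int (sign \<pi>) * (\<Prod>l<m. M l (\<pi> l)))"
      by (simp add: sign_compose[OF \<pi>] prod.distrib)
  qed simp
  finally show ?thesis
    by (simp add: leibniz_det_def sum_distrib_left)
qed

lemma leibniz_det_zero_row:
  assumes "l < m" "\<And>k. k < m \<Longrightarrow> C l k = 0"
  shows "leibniz_det m C = 0"
proof -
  have "(\<Prod>l<m. C l (\<pi> l)) = 0" if "\<pi> permutes {..<m}" for \<pi>
    using assms permutes_in_image[OF that, of l] by (intro prod_zero) auto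
  then show ?thesis unfolding leibniz_det_def by (intro sum.neutral) simp
qed

lemma leibniz_det_identity: "leibniz_det m (\<lambda>l k. of_bool (k = l)) = 1"
proof -
  have "(\<Prod>l<m. of_bool (\<pi> l = l) :: real) = 0" if \<pi>: "\<pi> permutes {..<m}" and "\<pi> \<noteq> id" for \<pi>
  proof -
    obtain l where "\<pi> l \<noteq> l" using \<open>\<pi> \<noteq> id\<close> by (auto simp: fun_eq_iff)
    moreover from this have "l < m" using \<pi> by (auto simp: permutes_def)
    ultimately show ?thesis by (intro prod_zero) auto
  qed
  then have "leibniz_det m (\<lambda>l k. of_bool (k = l)) =
      (\<Sum>\<pi>\<in>{\<pi>. \<pi> permutes {..<m}}. if \<pi> = id then 1 else 0)"
    unfolding leibniz_det_def by (intro sum.cong) auto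
  also have "\<dots> = 1"
    by (subst sum.delta) (auto simp: finite_permutations permutes_id)
  finally show ?thesis .
qed

lemma leibniz_det_2: "leibniz_det 2 C = C 0 0 * C 1 1 - C 0 1 * C 1 0"
proof -
  have "{\<pi>. \<pi> permutes {..<2::nat}} = {id, Transposition.transpose 0 1}"
    using permutes_doubleton_iff[of _ "0::nat" 1] by (auto simp: lessThan_Suc numeral_2_eq_2 insert_commute)
  moreover have "id \<noteq> Transposition.transpose (0::nat) 1"
    by (auto simp: fun_eq_iff Transposition.transpose_def)
  ultimately have "leibniz_det 2 C = (\<Prod>l<2. C l l) - (\<Prod>l<2. C l (Transposition.transpose 0 1 l))"
    by (simp add: leibniz_det_def sign_swap_id)
  then show ?thesis
    by (simp add: numeral_2_eq_2)
qed

text \<open>The representative modulo 1 in \<open>[-1/2, 1/2)\<close>, which lifts a small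
  displacement on a circle to the reals.\<close>

definition centered_frac :: "real \<Rightarrow> real" where
  "centered_frac t = t - of_int (round t)"

lemma centered_frac_eq:
  assumes "\<bar>s\<bar> < 1/2" "t = s + of_int z"
  shows "centered_frac t = s"
proof -
  have "round t = z"
    using assms by (intro round_unique) auto
  then show ?thesis using assms by (simp add: centered_frac_def)
qed

lemma centered_frac_0 [simp]: "centered_frac 0 = 0"
  by (simp add: centered_frac_def)

lemma centered_frac_shift: "centered_frac (t + of_int z) = centered_frac t"
proof -
  have "round (t + of_int z) = round t + z"
  proof -
    have "t + of_int z + 1/2 = (t + 1/2) + of_int z" by simp
    then show ?thesis unfolding round_def by (simp only: floor_add_int[symmetric])
  qed
  then show ?thesis by (simp add: centered_frac_def)
qed

lemma centered_frac_small:
  assumes "\<bar>t - of_int k\<bar> < 1/8"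
  shows "\<bar>centered_frac t\<bar> < 1/8"
  using centered_frac_eq[of "t - of_int k" t k] assms by simp

text \<open>Pigeonhole: each of the \<open>n\<close> labels can drop only once, from two elements to
  one, and each of the \<open>n\<close> steps needs a drop, so choosing a dropping label for each
  step gives a permutation.\<close>

lemma staircase:
  fixes A :: "nat \<Rightarrow> nat \<Rightarrow> 'v set"
  assumes card: "\<And>k i. k \<le> n \<Longrightarrow> i < n \<Longrightarrow> card (A k i) = 1 \<or> card (A k i) = 2"
    and mono: "\<And>l i. l < n \<Longrightarrow> i < n \<Longrightarrow> A (Suc l) i \<subseteq> A l i"
    and strict: "\<And>l. l < n \<Longrightarrow> \<exists>i<n. A (Suc l) i \<noteq> A l i"
  shows "\<exists>\<rho>. \<rho> permutes {..<n} \<and> (\<forall>l<n. card (A l (\<rho> l)) = 2 \<and> card (A (Suc l) (\<rho> l)) = 1)"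
proof -
  have fin: "finite (A k i)" if "k \<le> n" "i < n" for k i
    using card[OF that] by (metis card.infinite zero_neq_one zero_neq_numeral)
  have anti: "A k' i \<subseteq> A k i" if "k \<le> k'" "k' \<le> n" "i < n" for k k' i
    using that
  proof (induction k' rule: dec_induct)
    case (step k')
    then show ?case using mono[of k' i] by auto
  qed simp
  obtain \<sigma> where \<sigma>: "\<And>l. l < n \<Longrightarrow> \<sigma> l < n \<and> A (Suc l) (\<sigma> l) \<noteq> A l (\<sigma> l)"
    using strict by metis
  define \<rho> where "\<rho> l = (if l < n then \<sigma> l else l)" for l
  have \<rho>: "\<rho> l < n" "A (Suc l) (\<rho> l) \<subset> A l (\<rho> l)" if "l < n" for l
    using \<sigma>[OF that] mono[OF that] that by (auto simp: \<rho>_def)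
  have c: "card (A l (\<rho> l)) = 2" "card (A (Suc l) (\<rho> l)) = 1" if "l < n" for l
  proof -
    have "card (A (Suc l) (\<rho> l)) < card (A l (\<rho> l))"
      using \<rho>[OF that] fin[of l "\<rho> l"] that by (intro psubset_card_mono) auto
    then show "card (A l (\<rho> l)) = 2" "card (A (Suc l) (\<rho> l)) = 1"
      using card[of l "\<rho> l"] card[of "Suc l" "\<rho> l"] \<rho>(1)[OF that] that by auto
  qed
  have ne: "\<rho> l \<noteq> \<rho> l'" if "l < l'" "l' < n" for l l'
  proof
    assume eq: "\<rho> l = \<rho> l'"
    have "card (A l' (\<rho> l')) \<le> card (A (Suc l) (\<rho> l'))"
      using that \<rho>(1)[of l'] by (intro card_mono anti fin) auto
    then show False using c(1)[of l'] c(2)[of l] that eq by simp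
  qed
  have "inj_on \<rho> {..<n}"
    by (rule inj_onI) (metis ne lessThan_iff linorder_neqE_nat)
  moreover have "\<rho> ` {..<n} \<subseteq> {..<n}" using \<rho>(1) by auto
  ultimately have "bij_betw \<rho> {..<n} {..<n}"
    using endo_inj_surj[of "{..<n}" \<rho>] by (simp add: bij_betw_def)
  then have "\<rho> permutes {..<n}"
    by (rule bij_imp_permutes) (simp add: \<rho>_def)
  with c show ?thesis by blast
qed

section \<open>Coordinate tori inside the skeleton\<close>

definition coord_embedding :: "(nat \<Rightarrow> nat) \<Rightarrow> nat \<Rightarrow> (nat \<Rightarrow> int) \<Rightarrow> nat \<Rightarrow> int" where
  "coord_embedding \<iota> m x = (\<lambda>c. if c \<in> \<iota> ` {..<m} then x (inv_into {..<m} \<iota> c) else 0)"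

lemma coord_embedding_upd:
  assumes "inj_on \<iota> {..<m}" "k < m"
  shows "coord_embedding \<iota> m (x(k := t)) = (coord_embedding \<iota> m x)(\<iota> k := t)"
proof
  fix c
  show "coord_embedding \<iota> m (x(k := t)) c = ((coord_embedding \<iota> m x)(\<iota> k := t)) c"
  proof (cases "c \<in> \<iota> ` {..<m}")
    case True
    then obtain j where "j < m" "c = \<iota> j" by auto
    with assms show ?thesis by (auto simp: coord_embedding_def inv_into_f_f inj_on_def)
  next
    case False
    with assms show ?thesis by (auto simp: coord_embedding_def)
  qed
qed

lemma coord_embedding_at: "inj_on \<iota> {..<m} \<Longrightarrow> k < m \<Longrightarrow> coord_embedding \<iota> m x (\<iota> k) = x k"
  by (simp add: coord_embedding_def)

lemma coord_embedding_outside: "c \<notin> \<iota> ` {..<m} \<Longrightarrow> coord_embedding \<iota> m x c = 0"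
  by (auto simp: coord_embedding_def)

lemma coord_embedding_restrict: "coord_embedding \<iota> m (restrict_coords m x) = coord_embedding \<iota> m x"
  using inv_into_into[of _ \<iota> "{..<m}"] by (auto simp: coord_embedding_def restrict_coords_def fun_eq_iff)

lemma coord_embedding_zero: "coord_embedding \<iota> m (\<lambda>_. 0) = (\<lambda>_. 0)"
  by (auto simp: coord_embedding_def)

text \<open>The lattice points \<open>x\<close> with \<open>R dvd x j\<close> for some \<open>j \<le> n\<close> form the \<open>n\<close>-skeleton of the \<open>(n+1)\<close>-torus of side \<open>R\<close>.\<close>

locale grid_cover =
  fixes n :: nat and R :: int and g :: "nat \<Rightarrow> (nat \<Rightarrow> int) \<Rightarrow> 'v set"
  assumes n2: "2 \<le> n" and R: "even R" "16 \<le> R"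
    and card_g: "\<And>i j x. i < n \<Longrightarrow> j \<le> n \<Longrightarrow> R dvd x j \<Longrightarrow> card (g i x) = 1 \<or> card (g i x) = 2"
    and per_g: "\<And>i j k x. i < n \<Longrightarrow> k \<le> n \<Longrightarrow> j \<le> n \<Longrightarrow> R dvd x j \<Longrightarrow> g i (x(k := x k + R)) = g i x"
    and mono_g: "\<And>i j k x s. i < n \<Longrightarrow> k \<le> n \<Longrightarrow> j \<le> n \<Longrightarrow> j \<noteq> k \<Longrightarrow> R dvd x j \<Longrightarrow> even (x k) \<Longrightarrow>
      s = 1 \<or> s = -1 \<Longrightarrow> g i (x(k := x k + s)) \<subseteq> g i x"
    and small_g: "\<And>j j' x y c. j \<le> n \<Longrightarrow> R dvd x j \<Longrightarrow> j' \<le> n \<Longrightarrow> R dvd y j' \<Longrightarrow>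
      (\<And>i. i < n \<Longrightarrow> g i x \<inter> g i y \<noteq> {}) \<Longrightarrow> c \<le> n \<Longrightarrow>
      \<exists>k::int. \<bar>real_of_int (x c - y c) / of_int R - of_int k\<bar> < 1/8"
begin

lemma R0: "0 < R" using R by simp

text \<open>The coordinate \<open>j\<close> outside the image stays 0, a multiple of
  \<open>R\<close>; this keeps the torus in the skeleton, where the conditions of the locale
  hold.\<close>

lemma torus_map_coord_embedding:
  assumes \<iota>: "inj_on \<iota> {..<m}" "\<iota> ` {..<m} \<subseteq> {..n}" and j: "j \<le> n" "j \<notin> \<iota> ` {..<m}" and i: "i < n"
  shows "torus_map m R (\<lambda>x. g i (coord_embedding \<iota> m x))"
  unfolding torus_map_def
proof (intro conjI allI impI)
  have dvd: "R dvd coord_embedding \<iota> m x j" for x using coord_embedding_outside[OF j(2)] by simp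
  fix x k and s :: int
  show "card (g i (coord_embedding \<iota> m x)) = 1 \<or> card (g i (coord_embedding \<iota> m x)) = 2"
    by (rule card_g[where j = j, OF i j(1)]) (rule dvd)
  show "g i (coord_embedding \<iota> m (restrict_coords m x)) = g i (coord_embedding \<iota> m x)"
    by (simp add: coord_embedding_restrict)
  assume k: "k < m"
  then have "\<iota> k \<le> n" "j \<noteq> \<iota> k" using \<iota>(2) j by auto
  then show "g i (coord_embedding \<iota> m (x(k := x k + R))) = g i (coord_embedding \<iota> m x)"
    using per_g[where x = "coord_embedding \<iota> m x" and j = j and k = "\<iota> k", OF i _ j(1) dvd] by (simp add: coord_embedding_upd[OF \<iota>(1) k] coord_embedding_at[OF \<iota>(1) k])
  assume "even (x k)" "s = 1 \<or> s = -1"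
  then show "g i (coord_embedding \<iota> m (x(k := x k + s))) \<subseteq> g i (coord_embedding \<iota> m x)"
    using mono_g[where x = "coord_embedding \<iota> m x" and j = j and s = s, OF i \<open>\<iota> k \<le> n\<close> j(1) \<open>j \<noteq> \<iota> k\<close> dvd]
    by (simp add: coord_embedding_upd[OF \<iota>(1) k] coord_embedding_at[OF \<iota>(1) k])
qed

lemma period_coord_embedding:
  assumes "inj_on \<iota> {..<m}" "k < m"
  shows "period R (\<lambda>x. g i (coord_embedding \<iota> m x)) e a k = period R (g i) e a (\<iota> k)"
  unfolding period_def coord_embedding_upd[OF assms] coord_embedding_zero ..

text \<open>A step to a vertex of the graph cannot be followed by a step from an edge, so the cup product of two
cocycles of the same graph vanishes on the 2-torus in the directions \<open>k\<close>, \<open>l\<close>.\<close>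

lemma periods_parallel:
  assumes i: "i < n" and ea: "card e = 2" "card a = 1" "card e' = 2" "card a' = 1" and kl: "k \<le> n" "l \<le> n"
  shows "period R (g i) e a k * period R (g i) e' a' l = period R (g i) e a l * period R (g i) e' a' k"
proof (cases "k = l")
  case False
  define \<iota> where "\<iota> x = (if x = 0 then k else l)" for x :: nat
  have \<iota>: "inj_on \<iota> {..<2}" "\<iota> ` {..<2} \<subseteq> {..n}"
    using False kl by (auto simp: inj_on_def \<iota>_def)
  have im: "\<iota> ` {..<2} \<subseteq> {k, l}" by (auto simp: \<iota>_def)
  \<comment> \<open>As \<open>n\<close> is at least 2, there is a third coordinate, to be held at
    0.\<close>
  have "card {k, l} < card {..n}" using n2 False by simp
  then have "\<not> {..n} \<subseteq> {k, l}" by (meson card_mono finite.emptyI finite_insert leD)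
  then obtain j where j: "j \<le> n" "j \<notin> \<iota> ` {..<2}" using im by auto
  let ?G = "\<lambda>x. g i (coord_embedding \<iota> 2 x)"
  let ?e = "\<lambda>l. if l = 0 then e else e'" and ?a = "\<lambda>l. if l = 0 then a else a'"
  have "cycle_sum 2 R (\<lambda>v. \<Prod>l<2. of_bool (?G (v l) = ?e l \<and> ?G (v (Suc l)) = ?a l)) =
      leibniz_det 2 (\<lambda>l. period R ?G (?e l) (?a l))"
    by (rule cycle_sum_cup[OF torus_map_coord_embedding[OF \<iota> j i] R(1) R0]) (use ea in auto)
  moreover have "(\<lambda>v::nat \<Rightarrow> nat \<Rightarrow> int. \<Prod>l<2. of_bool (?G (v l) = ?e l \<and> ?G (v (Suc l)) = ?a l) :: real) = (\<lambda>v. 0)"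
    using ea by (auto simp: fun_eq_iff numeral_2_eq_2)
  ultimately have "leibniz_det 2 (\<lambda>l. period R ?G (?e l) (?a l)) = 0"
    by (simp add: cycle_sum_def)
  moreover have "\<iota> 0 = k" "\<iota> 1 = l" by (auto simp: \<iota>_def)
  ultimately show ?thesis
    using period_coord_embedding[OF \<iota>(1), of 0 i] period_coord_embedding[OF \<iota>(1), of 1 i] by (simp add: leibniz_det_2)
qed simp

lemma periods_proportional:
  assumes i: "i < n"
  shows "\<exists>\<gamma>. \<forall>e a. card e = 2 \<longrightarrow> card a = 1 \<longrightarrow> (\<exists>\<mu>. \<forall>c\<le>n. period R (g i) e a c = \<mu> * \<gamma> c)"
proof (cases "\<exists>e a c. card e = 2 \<and> card a = 1 \<and> c \<le> n \<and> period R (g i) e a c \<noteq> 0")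
  case True
  then obtain e a c where *: "card e = 2" "card a = 1" "c \<le> n" "period R (g i) e a c \<noteq> 0" by blast
  have "period R (g i) e' a' c' = (period R (g i) e' a' c / period R (g i) e a c) * period R (g i) e a c'"
    if "card e' = 2" "card a' = 1" "c' \<le> n" for e' a' c'
    using periods_parallel[OF i that(1,2) *(1,2) that(3) *(3)] *(4) by (simp add: field_simps)
  then show ?thesis by blast
next
  case False
  then have "\<forall>e a. card e = 2 \<longrightarrow> card a = 1 \<longrightarrow> (\<forall>c\<le>n. period R (g i) e a c = 0 * 0)" by auto
  then show ?thesis by (intro exI[of _ "\<lambda>_. 0"]) auto
qed

section \<open>Coordinate cocycles expressed through the labels\<close>

definition labels :: "(nat \<Rightarrow> int) \<Rightarrow> nat \<Rightarrow> 'v set" where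
  "labels x = (\<lambda>i. if i < n then g i x else {})"

text \<open>A section of \<open>labels\<close> over the skeleton: it makes coordinates functions of
  the labels alone. The choice is harmless, since by \<open>small_g\<close> all points with the same
  labels are close modulo the period.\<close>

definition grid_section :: "(nat \<Rightarrow> 'v set) \<Rightarrow> nat \<Rightarrow> int" where
  "grid_section \<alpha> = (SOME x. (\<exists>j\<le>n. R dvd x j) \<and> labels x = \<alpha>)"

lemma grid_section: "j \<le> n \<Longrightarrow> R dvd x j \<Longrightarrow> (\<exists>j\<le>n. R dvd grid_section (labels x) j) \<and> labels (grid_section (labels x)) = labels x"
  unfolding grid_section_def by (rule someI[where x = x]) blast

lemma centered_frac_section_small:
  assumes "j \<le> n" "R dvd x j" "c \<le> n"
  shows "\<bar>centered_frac (of_int (grid_section (labels x) c - x c) / of_int R)\<bar> < 1/8"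
proof -
  obtain j' where j': "j' \<le> n" "R dvd grid_section (labels x) j'" and eq: "labels (grid_section (labels x)) = labels x"
    using grid_section[where x = x and j = j, OF assms(1,2)] by blast
  have "g i (grid_section (labels x)) \<inter> g i x \<noteq> {}" if "i < n" for i
  proof -
    have "g i (grid_section (labels x)) = g i x"
      using fun_cong[OF eq, of i] that by (simp add: labels_def)
    moreover have "g i x \<noteq> {}" using card_g[where x = x and j = j, OF that assms(1,2)] by auto
    ultimately show ?thesis by simp
  qed
  from small_g[where x = "grid_section (labels x)" and y = x and j = j' and j' = j, OF j' assms(1,2) this assms(3)]
  show ?thesis using centered_frac_small by blast
qed

text \<open>Only \<open>a = 0\<close>, which omits coordinate \<open>n\<close>, and
  \<open>a = 1\<close>, which omits coordinate 0, will occur.\<close>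

abbreviation shift_embedding :: "nat \<Rightarrow> (nat \<Rightarrow> int) \<Rightarrow> nat \<Rightarrow> int" where
  "shift_embedding a \<equiv> coord_embedding (\<lambda>k. k + a) n"

lemma shift_embedding:
  assumes "a \<le> 1"
  shows "inj_on (\<lambda>k. k + a) {..<n}" "(\<lambda>k. k + a) ` {..<n} \<subseteq> {..n}"
    "\<exists>j\<le>n. j \<notin> (\<lambda>k. k + a) ` {..<n}"
proof -
  show "\<exists>j\<le>n. j \<notin> (\<lambda>k. k + a) ` {..<n}"
  proof (cases "a = 0")
    case True
    then show ?thesis by (intro exI[of _ n]) auto
  next
    case False
    then show ?thesis by (intro exI[of _ 0]) auto
  qed
qed (use assms in auto)

text \<open>The product of the coordinate cocycles in the directions \<open>b\<close>, ...,
  \<open>b + n - 1\<close>, computed at the chosen points; it sees a simplex only through its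
  sequence \<open>A\<close> of labels.\<close>

definition section_cup :: "nat \<Rightarrow> (nat \<Rightarrow> nat \<Rightarrow> 'v set) \<Rightarrow> real" where
  "section_cup b A = (\<Prod>l<n. centered_frac (of_int (grid_section (A (Suc l)) (l + b) - grid_section (A l) (l + b)) / of_int R))"

text \<open>\<open>grid_section \<circ> labels\<close> moves points only a little, so the coordinate cocycles pulled back along it keep their periods.\<close>

lemma cycle_sum_section_cup:
  assumes a: "a \<le> 1" and b: "b \<le> 1"
  shows "cycle_sum n R (\<lambda>v. section_cup b (\<lambda>k. labels (shift_embedding a (v k)))) = (if a = b then 1 else 0)"
proof -
  let ?E = "shift_embedding a"
  obtain j where j: "j \<le> n" "j \<notin> (\<lambda>k. k + a) ` {..<n}" using shift_embedding(3)[OF a] by blast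
  have dvd: "R dvd ?E x j" for x using coord_embedding_outside[OF j(2)] by simp
  \<comment> \<open>The coordinate plus the centred displacement of the chosen point. The second
    term is periodic, so the periods are those of the coordinate.\<close>
  define F where "F l x = of_int (?E x (l + b)) / of_int R + centered_frac (of_int (grid_section (labels (?E x)) (l + b) - ?E x (l + b)) / of_int R)" for l x
  have Eupd: "?E (x(k := t)) = (?E x)(k + a := t)" "?E x (k + a) = x k" if "k < n" for k t x
    using coord_embedding_upd[OF shift_embedding(1)[OF a] that] coord_embedding_at[OF shift_embedding(1)[OF a] that] by auto
  have q: "qperiodic n R (F l) (\<lambda>k. of_bool (k + a = l + b))" if l: "l < n" for l
    unfolding qperiodic_def
  proof (intro allI impI)
    fix x k assume k: "k < n"
    have "k + a \<le> n" using k a by simp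
    then have *: "g i (?E (x(k := x k + R))) = g i (?E x)" if "i < n" for i
      using per_g[where x = "?E x" and j = j and k = "k + a", OF that _ j(1) dvd] Eupd[OF k] by simp
    have gge: "labels (?E (x(k := x k + R))) = labels (?E x)"
      unfolding labels_def by (intro ext if_cong refl) (rule *)
    show "F l (x(k := x k + R)) = F l x + of_bool (k + a = l + b)"
    proof (cases "k + a = l + b")
      case True
      define s y where "s = grid_section (labels (?E x)) (l + b)" and "y = ?E x (l + b)"
      have E: "?E (x(k := x k + R)) (l + b) = y + R"
        unfolding y_def True[symmetric] Eupd(1)[OF k] by (simp add: Eupd(2)[OF k])
      have "of_int (s - (y + R)) / of_int R = of_int (s - y) / of_int R + real_of_int (-1)"
        using R0 by (simp add: field_simps)
      then have "centered_frac (of_int (s - (y + R)) / of_int R) = centered_frac (of_int (s - y) / of_int R)"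
        using centered_frac_shift by metis
      moreover have "real_of_int (y + R) / of_int R = of_int y / of_int R + 1"
        using R0 by (simp add: field_simps)
      ultimately show ?thesis
        using True unfolding F_def gge E by (simp add: s_def[symmetric] y_def[symmetric])
    next
      case False
      then show ?thesis unfolding F_def gge using Eupd[OF k] by simp
    qed
  qed
  have "cycle_sum n R (\<lambda>v. section_cup b (\<lambda>k. labels (?E (v k)))) = cycle_sum n R (\<lambda>v. \<Prod>l<n. F l (v (Suc l)) - F l (v l))"
    unfolding cycle_sum_def section_cup_def
  proof (intro sum.cong arg_cong2[where f = "(*)"] prod.cong refl)
    fix z l assume z: "z \<in> top_simplices n R" and "l \<in> {..<n}"
    then have l: "l < n" "l + b \<le> n" using b by auto
    obtain p s \<pi> where zz: "z = (p, s, \<pi>)" by (cases z)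
    define k where "k = \<pi> l"
    have "\<pi> permutes {..<n}" using z by (simp add: zz top_simplices_def)
    then have k: "k < n" using l permutes_in_image[of \<pi> "{..<n}" l] by (simp add: k_def)
    have s: "s k = 1 \<or> s k = -1"
      using z k by (auto simp: zz top_simplices_def PiE_iff)
    have v: "vertex z (Suc l) = (vertex z l)(k := vertex z l k + s k)"
      using vertex_Suc[OF z[unfolded zz] l(1)] by (simp_all add: zz k_def)
    define u u' where "u = ?E (vertex z l) (l + b)" and "u' = ?E (vertex z (Suc l)) (l + b)"
    define h h' where "h = grid_section (labels (?E (vertex z l))) (l + b)" and "h' = grid_section (labels (?E (vertex z (Suc l)))) (l + b)"
    have du: "\<bar>real_of_int (u' - u)\<bar> \<le> 1"
      unfolding u_def u'_def v Eupd(1)[OF k] using Eupd(2)[OF k] s by auto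
    define d d' where "d = centered_frac (of_int (h - u) / of_int R)" and "d' = centered_frac (of_int (h' - u') / of_int R)"
    have d: "\<bar>d\<bar> < 1/8" "\<bar>d'\<bar> < 1/8"
      unfolding d_def d'_def h_def h'_def u_def u'_def by (rule centered_frac_section_small[where j = j]; use j(1) dvd l(2) in simp)+
    have "\<bar>real_of_int (u' - u) / of_int R\<bar> \<le> 1/16"
    proof -
      have "\<bar>real_of_int (u' - u) / of_int R\<bar> = \<bar>real_of_int (u' - u)\<bar> / of_int R"
        using R0 by simp
      also have "\<dots> \<le> 1 / 16"
        using du R(2) by (intro frac_le) auto
      finally show ?thesis .
    qed
    then have "\<bar>real_of_int (u' - u) / of_int R + d' - d\<bar> < 1/2"
      using d by linarith
    moreover have "of_int (h' - h) / of_int R = real_of_int (u' - u) / of_int R + d' - d +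
      of_int (round (real_of_int (h' - u') / of_int R) - round (real_of_int (h - u) / of_int R))"
      unfolding d_def d'_def centered_frac_def by (simp add: diff_divide_distrib)
    ultimately have "centered_frac (of_int (h' - h) / of_int R) = real_of_int (u' - u) / of_int R + d' - d"
      by (rule centered_frac_eq)
    then show "centered_frac (of_int (grid_section (labels (?E (vertex z (Suc l)))) (l + b) - grid_section (labels (?E (vertex z l))) (l + b)) / of_int R) =
        F l (vertex z (Suc l)) - F l (vertex z l)"
      unfolding F_def h_def[symmetric] h'_def[symmetric] u_def[symmetric] u'_def[symmetric]
        d_def[symmetric] d'_def[symmetric] by (simp add: diff_divide_distrib)
  qed
  also have "\<dots> = leibniz_det n (\<lambda>l k. of_bool (k + a = l + b))"
    by (rule cycle_sum_det[OF R(1) R0 q])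
  also have "\<dots> = (if a = b then 1 else 0)"
  proof (cases "a = b")
    case True
    then show ?thesis using leibniz_det_identity[of n] by simp
  next
    case False
    \<comment> \<open>One of the \<open>n\<close> cocycles runs in the direction missing from the
      torus, so the matrix of periods has a zero row.\<close>
    then consider "a = 0" "b = 1" | "a = 1" "b = 0" using a b by linarith
    then show ?thesis
    proof cases
      case 1
      then show ?thesis using n2 by (auto intro!: leibniz_det_zero_row[of "n - 1"])
    next
      case 2
      then show ?thesis using n2 by (auto intro!: leibniz_det_zero_row[of 0])
    qed
  qed
  finally show ?thesis .
qed

text \<open>The constant value beyond \<open>n\<close> makes equality of itineraries a comparison of
  the \<open>n+1\<close> vertices of a simplex only.\<close>

definition itinerary :: "nat \<Rightarrow> (nat \<Rightarrow> nat \<Rightarrow> int) \<Rightarrow> nat \<Rightarrow> nat \<Rightarrow> 'v set" where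
  "itinerary a v = (\<lambda>k. if k \<le> n then labels (shift_embedding a (v k)) else (\<lambda>_. {}))"

lemma torus_map_shift: "a \<le> 1 \<Longrightarrow> i < n \<Longrightarrow> torus_map n R (\<lambda>x. g i (shift_embedding a x))"
  using shift_embedding[of a] torus_map_coord_embedding by blast

lemma itinerary_props:
  assumes a: "a \<le> 1" and z: "z \<in> top_simplices n R" and i: "i < n"
  shows "k \<le> n \<Longrightarrow> card (itinerary a (vertex z) k i) = 1 \<or> card (itinerary a (vertex z) k i) = 2"
    and "k \<le> l \<Longrightarrow> l \<le> n \<Longrightarrow> itinerary a (vertex z) l i \<subseteq> itinerary a (vertex z) k i"
proof -
  note G = torus_map_shift[OF a i]
  show "k \<le> n \<Longrightarrow> card (itinerary a (vertex z) k i) = 1 \<or> card (itinerary a (vertex z) k i) = 2"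
    using G i unfolding itinerary_def labels_def torus_map_def by simp
  have "k \<le> l \<Longrightarrow> l \<le> n \<Longrightarrow> g i (shift_embedding a (vertex z l)) \<subseteq> g i (shift_embedding a (vertex z k))"
  proof (induction l rule: dec_induct)
    case (step l)
    then show ?case using vertex_step(1)[OF G z, of l] by simp
  qed simp
  then show "k \<le> l \<Longrightarrow> l \<le> n \<Longrightarrow> itinerary a (vertex z) l i \<subseteq> itinerary a (vertex z) k i"
    using i unfolding itinerary_def labels_def by simp
qed

text \<open>If factor \<open>\<rho> l\<close> has two elements at vertex \<open>l\<close> and one at
  vertex \<open>Suc l\<close>, monotonicity and the bounds on sizes fix it at all other vertices: it
  is constant before and after this step. So \<open>n\<close> local conditions, one for each step
  and factor, detect the whole itinerary, and their product is a cup product.\<close>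

lemma itinerary_eq_iff:
  assumes a: "a \<le> 1" and z: "z \<in> top_simplices n R" and a0: "a0 \<le> 1" and z0: "z0 \<in> top_simplices n R"
    and A: "A = itinerary a0 (vertex z0)" and \<rho>: "\<rho> permutes {..<n}"
    and c: "\<And>l. l < n \<Longrightarrow> card (A l (\<rho> l)) = 2" "\<And>l. l < n \<Longrightarrow> card (A (Suc l) (\<rho> l)) = 1"
  shows "itinerary a (vertex z) = A \<longleftrightarrow>
    (\<forall>l<n. g (\<rho> l) (shift_embedding a (vertex z l)) = A l (\<rho> l) \<and> g (\<rho> l) (shift_embedding a (vertex z (Suc l))) = A (Suc l) (\<rho> l))"
proof
  have \<rho>n: "\<rho> l < n" if "l < n" for l
    using permutes_in_image[OF \<rho>, of l] that by simp
  assume "itinerary a (vertex z) = A"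
  then have *: "labels (shift_embedding a (vertex z k)) i = A k i" if "k \<le> n" for k i
    using that unfolding itinerary_def by auto
  show "\<forall>l<n. g (\<rho> l) (shift_embedding a (vertex z l)) = A l (\<rho> l) \<and> g (\<rho> l) (shift_embedding a (vertex z (Suc l))) = A (Suc l) (\<rho> l)"
  proof (intro allI impI conjI)
    fix l assume l: "l < n"
    show "g (\<rho> l) (shift_embedding a (vertex z l)) = A l (\<rho> l)" "g (\<rho> l) (shift_embedding a (vertex z (Suc l))) = A (Suc l) (\<rho> l)"
      using *[of l "\<rho> l"] *[of "Suc l" "\<rho> l"] l \<rho>n[OF l] by (simp_all add: labels_def)
  qed
next
  have \<rho>n: "\<rho> l < n" if "l < n" for l
    using permutes_in_image[OF \<rho>, of l] that by simp
  assume *: "\<forall>l<n. g (\<rho> l) (shift_embedding a (vertex z l)) = A l (\<rho> l) \<and> g (\<rho> l) (shift_embedding a (vertex z (Suc l))) = A (Suc l) (\<rho> l)"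
  define B where "B = itinerary a (vertex z)"
  have B: "B l (\<rho> l) = A l (\<rho> l)" "B (Suc l) (\<rho> l) = A (Suc l) (\<rho> l)" if "l < n" for l
    using * that \<rho>n[OF that] by (simp_all add: B_def itinerary_def labels_def)
  have determined: "T k i = (if k \<le> l then A l i else A (Suc l) i)"
    if T: "T l i = A l i" "T (Suc l) i = A (Suc l) i" "l < n" "k \<le> n" "i = \<rho> l"
      "\<And>k. k \<le> n \<Longrightarrow> card (T k i) = 1 \<or> card (T k i) = 2"
      "\<And>k l. k \<le> l \<Longrightarrow> l \<le> n \<Longrightarrow> T l i \<subseteq> T k i" for T :: "nat \<Rightarrow> nat \<Rightarrow> 'v set" and k l i
  proof -
    have fin: "finite (T k i)" if "k \<le> n" for k
      using T(6)[OF that] by (metis card.infinite zero_neq_one zero_neq_numeral)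
    show ?thesis
    proof (cases "k \<le> l")
      case True
      have sub: "T l i \<subseteq> T k i" using T(3,7) True by simp
      have "card (T l i) = 2" using T(1,3,5) c(1) by simp
      moreover have "card (T l i) \<le> card (T k i)" using sub fin T(4) by (simp add: card_mono)
      ultimately have "card (T l i) = card (T k i)" using T(6)[OF T(4)] by linarith
      then show ?thesis using card_subset_eq[OF fin[OF T(4)] sub] True T(1) by simp
    next
      case False
      have sub: "T k i \<subseteq> T (Suc l) i" using T(4,7) False by simp
      have fS: "finite (T (Suc l) i)" using fin T(3) by simp
      have "card (T (Suc l) i) = 1" using T(2,3,5) c(2) by simp
      moreover have "card (T k i) \<le> card (T (Suc l) i)" using sub fS by (simp add: card_mono)
      ultimately have "card (T k i) = card (T (Suc l) i)" using T(6)[OF T(4)] by linarith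
      then show ?thesis using card_subset_eq[OF fS sub] False T(2) by simp
    qed
  qed
  have "B k i = A k i" for k i
  proof (cases "k \<le> n \<and> i < n")
    case True
    have "i \<in> \<rho> ` {..<n}" using True permutes_image[OF \<rho>] by simp
    then obtain l where l: "l < n" "i = \<rho> l" by auto
    have "B k i = (if k \<le> l then A l i else A (Suc l) i)"
      by (rule determined) (use l B itinerary_props[OF a z] True in \<open>auto simp: B_def\<close>)
    moreover have "A k i = (if k \<le> l then A l i else A (Suc l) i)"
      by (rule determined) (use l itinerary_props[OF a0 z0] True in \<open>auto simp: A\<close>)
    ultimately show ?thesis by simp
  next
    case False
    then show ?thesis unfolding B_def A itinerary_def labels_def by auto
  qed
  then show "itinerary a (vertex z) = A" unfolding B_def by blast
qed

text \<open>The point is that \<open>\<kappa>\<close> does not depend on \<open>a\<close>. The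
  indicator is a cup product of one cocycle from each graph, in the order \<open>\<rho>\<close>; the
  factors \<open>\<mu> l\<close> by which the period vectors differ from the rows of
  \<open>\<gamma>\<close> and the sign of \<open>\<rho>\<close> are the same for both tori.\<close>

lemma cycle_sum_itinerary:
  assumes \<gamma>: "\<And>i e a. i < n \<Longrightarrow> card e = 2 \<Longrightarrow> card a = 1 \<Longrightarrow> \<exists>\<mu>. \<forall>c\<le>n. period R (g i) e a c = \<mu> * \<gamma> i c"
    and a0: "a0 \<le> 1" and z0: "z0 \<in> top_simplices n R" and A: "A = itinerary a0 (vertex z0)"
    and strict: "\<And>l. l < n \<Longrightarrow> A (Suc l) \<noteq> A l"
  shows "\<exists>\<kappa>. \<forall>a\<le>1. cycle_sum n R (\<lambda>v. of_bool (itinerary a v = A)) = \<kappa> * leibniz_det n (\<lambda>i k. \<gamma> i (k + a))"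
proof -
  have *: "\<exists>i<n. A (Suc l) i \<noteq> A l i" if l: "l < n" for l
  proof -
    obtain i where i: "A (Suc l) i \<noteq> A l i" using strict[OF l] by blast
    then have "i < n" using l unfolding A itinerary_def labels_def by (auto split: if_splits)
    with i show ?thesis by blast
  qed
  obtain \<rho> where \<rho>: "\<rho> permutes {..<n}"
    and c: "\<And>l. l < n \<Longrightarrow> card (A l (\<rho> l)) = 2" "\<And>l. l < n \<Longrightarrow> card (A (Suc l) (\<rho> l)) = 1"
  proof -
    have "card (A k i) = 1 \<or> card (A k i) = 2" if "k \<le> n" "i < n" for k i
      unfolding A by (rule itinerary_props(1)[OF a0 z0 that(2,1)])
    moreover have "A (Suc l) i \<subseteq> A l i" if "l < n" "i < n" for l i
      unfolding A by (rule itinerary_props(2)[OF a0 z0]) (use that in simp_all)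
    ultimately show thesis using staircase[of n A] * that by blast
  qed
  have \<rho>n: "\<rho> l < n" if "l < n" for l
    using permutes_in_image[OF \<rho>, of l] that by simp
  have "\<forall>l. \<exists>\<mu>. l < n \<longrightarrow> (\<forall>c\<le>n. period R (g (\<rho> l)) (A l (\<rho> l)) (A (Suc l) (\<rho> l)) c = \<mu> * \<gamma> (\<rho> l) c)"
    using \<gamma>[OF \<rho>n c] by blast
  then obtain \<mu> where \<mu>: "\<And>l c. l < n \<Longrightarrow> c \<le> n \<Longrightarrow>
      period R (g (\<rho> l)) (A l (\<rho> l)) (A (Suc l) (\<rho> l)) c = \<mu> l * \<gamma> (\<rho> l) c"
    by metis
  have "cycle_sum n R (\<lambda>v. of_bool (itinerary a v = A)) = ((\<Prod>l<n. \<mu> l) * of_int (sign \<rho>)) * leibniz_det n (\<lambda>i k. \<gamma> i (k + a))"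
    if a: "a \<le> 1" for a
  proof -
    have "cycle_sum n R (\<lambda>v. of_bool (itinerary a v = A)) =
        cycle_sum n R (\<lambda>v. \<Prod>l<n. of_bool (g (\<rho> l) (shift_embedding a (v l)) = A l (\<rho> l) \<and> g (\<rho> l) (shift_embedding a (v (Suc l))) = A (Suc l) (\<rho> l)))"
      unfolding cycle_sum_def
    proof (intro sum.cong arg_cong2[where f = "(*)"] refl)
      fix z assume z: "z \<in> top_simplices n R"
      have prod_bool: "(\<Prod>l<n. of_bool (Q l) :: real) = of_bool (\<forall>l<n. Q l)" for Q
        by (cases "\<forall>l<n. Q l") (auto intro!: prod_zero)
      show "of_bool (itinerary a (vertex z) = A) = (\<Prod>l<n. of_bool (g (\<rho> l) (shift_embedding a (vertex z l)) = A l (\<rho> l) \<and>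
          g (\<rho> l) (shift_embedding a (vertex z (Suc l))) = A (Suc l) (\<rho> l)) :: real)"
        unfolding prod_bool using itinerary_eq_iff[OF a z a0 z0 A \<rho> c] by (rule arg_cong[where f = of_bool])
    qed
    also have "\<dots> = leibniz_det n (\<lambda>l. period R (\<lambda>x. g (\<rho> l) (shift_embedding a x)) (A l (\<rho> l)) (A (Suc l) (\<rho> l)))"
      by (rule cycle_sum_cup[OF torus_map_shift[OF a \<rho>n] R(1) R0 c])
    also have "\<dots> = leibniz_det n (\<lambda>l k. \<mu> l * \<gamma> (\<rho> l) (k + a))"
    proof (rule leibniz_det_cong)
      fix l k assume l: "l < n" and k: "k < n"
      then have "k + a \<le> n" using a by simp
      then show "period R (\<lambda>x. g (\<rho> l) (shift_embedding a x)) (A l (\<rho> l)) (A (Suc l) (\<rho> l)) k = \<mu> l * \<gamma> (\<rho> l) (k + a)"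
        unfolding period_coord_embedding[OF shift_embedding(1)[OF a] k] by (rule \<mu>[OF l])
    qed
    also have "\<dots> = (\<Prod>l<n. \<mu> l) * of_int (sign \<rho>) * leibniz_det n (\<lambda>i k. \<gamma> i (k + a))"
      by (rule leibniz_det_rows[OF \<rho>])
    finally show ?thesis .
  qed
  then show ?thesis by blast
qed

lemma section_cup_itinerary: "section_cup b (\<lambda>k. labels (shift_embedding a (v k))) = section_cup b (itinerary a v)"
  unfolding section_cup_def itinerary_def by (intro prod.cong) auto

lemma section_cup_degenerate:
  assumes "l < n" "A (Suc l) = A l"
  shows "section_cup b A = 0"
  unfolding section_cup_def using assms by (intro prod_zero) (auto intro!: bexI[of _ l])

text \<open>Sorting the simplices of torus \<open>a\<close> by itinerary writes the value of the
  product of coordinate cocycles number \<open>b\<close> as a factor depending on \<open>b\<close>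
  times \<open>d a\<close>. By \<open>cycle_sum_section_cup\<close> these values form the identity
  matrix, which has rank two.\<close>

lemma inconsistent: False
proof -
  have "\<exists>\<gamma>. \<forall>i<n. \<forall>e a. card e = 2 \<longrightarrow> card a = 1 \<longrightarrow> (\<exists>\<mu>. \<forall>c\<le>n. period R (g i) e a c = \<mu> * \<gamma> i c)"
    using periods_proportional by metis
  then obtain \<gamma> where \<gamma>: "\<And>i e a. i < n \<Longrightarrow> card e = 2 \<Longrightarrow> card a = 1 \<Longrightarrow> \<exists>\<mu>. \<forall>c\<le>n. period R (g i) e a c = \<mu> * \<gamma> i c"
    by blast
  define d where "d a = leibniz_det n (\<lambda>i k. \<gamma> i (k + a))" for a
  define T where "T = (\<Union>a\<in>{0, 1::nat}. (\<lambda>z. itinerary a (vertex z)) ` top_simplices n R)"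
  have finT: "finite T" by (simp add: T_def finite_top_simplices)
  have "\<exists>\<kappa>. \<forall>a\<le>1. section_cup b A * cycle_sum n R (\<lambda>v. of_bool (itinerary a v = A)) = \<kappa> * d a" if "A \<in> T" for b A
  \<comment> \<open>An itinerary with a repetition has the same chosen point twice, so its
    \<open>section_cup\<close> is 0.\<close>
  proof (cases "\<forall>l<n. A (Suc l) \<noteq> A l")
    case True
    obtain a0 z0 where "a0 \<le> 1" "z0 \<in> top_simplices n R" "A = itinerary a0 (vertex z0)"
      using \<open>A \<in> T\<close> by (auto simp: T_def)
    from cycle_sum_itinerary[of \<gamma>, OF \<gamma> this] True
    obtain \<kappa> where "\<forall>a\<le>1. cycle_sum n R (\<lambda>v. of_bool (itinerary a v = A)) = \<kappa> * d a"
      unfolding d_def by blast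
    then show ?thesis by (intro exI[of _ "section_cup b A * \<kappa>"]) simp
  next
    case False
    then have "section_cup b A = 0" using section_cup_degenerate by blast
    then show ?thesis by (intro exI[of _ 0]) simp
  qed
  then have "\<forall>b A. \<exists>\<kappa>. A \<in> T \<longrightarrow> (\<forall>a\<le>1. section_cup b A * cycle_sum n R (\<lambda>v. of_bool (itinerary a v = A)) = \<kappa> * d a)"
    by blast
  then obtain \<kappa> where \<kappa>': "\<forall>b A. A \<in> T \<longrightarrow> (\<forall>a\<le>1. section_cup b A * cycle_sum n R (\<lambda>v. of_bool (itinerary a v = A)) = \<kappa> b A * d a)"
    unfolding choice_iff by blast
  then have \<kappa>: "section_cup b A * cycle_sum n R (\<lambda>v. of_bool (itinerary a v = A)) = \<kappa> b A * d a" if "A \<in> T" "a \<le> 1" for A b a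
    using that by blast
  have W: "(\<Sum>A\<in>T. \<kappa> b A) * d a = (if a = b then 1 else 0)" if a: "a \<le> 1" and b: "b \<le> 1" for a b
  proof -
    have "(if a = b then 1 else 0) = cycle_sum n R (\<lambda>v. section_cup b (itinerary a v))"
      using cycle_sum_section_cup[OF a b] by (simp add: section_cup_itinerary)
    also have "\<dots> = (\<Sum>z\<in>top_simplices n R. \<Sum>A\<in>T. orientation n z * (section_cup b A * of_bool (itinerary a (vertex z) = A)))"
      unfolding cycle_sum_def
    proof (rule sum.cong[OF refl])
      fix z assume "z \<in> top_simplices n R"
      moreover have "a = 0 \<or> a = 1" using a by linarith
      ultimately have "itinerary a (vertex z) \<in> T" by (auto simp: T_def)
      then have "(\<Sum>A\<in>T. section_cup b A * of_bool (itinerary a (vertex z) = A)) = section_cup b (itinerary a (vertex z))"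
        using finT by (simp add: sum.delta' of_bool_def if_distrib cong: if_cong)
      then show "orientation n z * section_cup b (itinerary a (vertex z)) = (\<Sum>A\<in>T. orientation n z * (section_cup b A * of_bool (itinerary a (vertex z) = A)))"
        by (simp add: sum_distrib_left[symmetric])
    qed
    also have "\<dots> = (\<Sum>A\<in>T. section_cup b A * cycle_sum n R (\<lambda>v. of_bool (itinerary a v = A)))"
      unfolding cycle_sum_def by (subst sum.swap) (simp add: sum_distrib_left mult_ac)
    also have "\<dots> = (\<Sum>A\<in>T. \<kappa> b A * d a)"
      using \<kappa>[OF _ a] by (intro sum.cong) auto
    finally show ?thesis by (simp add: sum_distrib_right)
  qed
  have "d 0 \<noteq> 0" using W[of 0 0] by auto
  moreover have "(\<Sum>A\<in>T. \<kappa> 1 A) \<noteq> 0" using W[of 1 1] by auto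
  ultimately show False using W[of 0 1] by simp
qed

end

section \<open>The skeleton of the torus inside the symmetric product\<close>

lemma openin_quotient_top:
  "openin (quotient_top X q) U \<longleftrightarrow> U \<subseteq> q ` topspace X \<and> openin X {x \<in> topspace X. q x \<in> U}"
proof -
  have "istopology (\<lambda>U. U \<subseteq> q ` topspace X \<and> openin X {x \<in> topspace X. q x \<in> U})"
    unfolding istopology_def
  proof (intro conjI allI impI)
    fix S T
    assume "S \<subseteq> q ` topspace X \<and> openin X {x \<in> topspace X. q x \<in> S}"
      and "T \<subseteq> q ` topspace X \<and> openin X {x \<in> topspace X. q x \<in> T}"
    moreover have "{x \<in> topspace X. q x \<in> S \<inter> T} = {x \<in> topspace X. q x \<in> S} \<inter> {x \<in> topspace X. q x \<in> T}"
      by auto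
    ultimately show "S \<inter> T \<subseteq> q ` topspace X" "openin X {x \<in> topspace X. q x \<in> S \<inter> T}"
      by (auto simp only: openin_Int)
  next
    fix \<K> assume *: "\<forall>K\<in>\<K>. K \<subseteq> q ` topspace X \<and> openin X {x \<in> topspace X. q x \<in> K}"
    then show "\<Union>\<K> \<subseteq> q ` topspace X" by blast
    have "{x \<in> topspace X. q x \<in> \<Union>\<K>} = (\<Union>K\<in>\<K>. {x \<in> topspace X. q x \<in> K})"
      by auto
    with * show "openin X {x \<in> topspace X. q x \<in> \<Union>\<K>}"
      by (simp only:) (intro openin_Union, auto)
  qed
  then show ?thesis
    by (simp add: quotient_top_def topology_inverse')
qed

lemma topspace_quotient_top: "topspace (quotient_top X q) = q ` topspace X"
proof -
  have "{x \<in> topspace X. q x \<in> q ` topspace X} = topspace X" by auto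
  then have "openin (quotient_top X q) (q ` topspace X)"
    by (simp add: openin_quotient_top)
  then show ?thesis
    by (intro subset_antisym openin_subset) (metis openin_quotient_top openin_topspace)
qed

lemma continuous_map_quotient_top: "continuous_map X (quotient_top X q) q"
  unfolding continuous_map_def by (auto simp: topspace_quotient_top openin_quotient_top)

section \<open>Parametrised circles and the orbits of tuples on them\<close>

definition circle_point :: "nat \<Rightarrow> real \<Rightarrow> complex" where
  "circle_point c t = of_nat (c + 1) * (1 - cis (2 * pi * t))"

lemma circle_point_in_sphere: "circle_point c t \<in> sphere (of_nat (c + 1)) (of_nat (c + 1))"
proof -
  have "dist (of_nat (c + 1)) (circle_point c t) = norm (of_nat (c + 1) * cis (2 * pi * t))"
    unfolding circle_point_def dist_norm by (simp add: algebra_simps)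
  also have "\<dots> = of_nat (c + 1)"
    by (simp only: norm_mult norm_cis norm_of_nat mult_1_right)
  finally show ?thesis by simp
qed

lemma circle_point_in_bouquet: "c \<le> n \<Longrightarrow> circle_point c t \<in> bouquet n"
  unfolding bouquet_def using circle_point_in_sphere[of c t] by (intro UN_I[of "c + 1"]) auto

lemma circle_point_shift: "circle_point c (t + of_int k) = circle_point c t"
proof -
  have "cis (2 * pi * (t + of_int k)) = cis (2 * pi * t) * cis (2 * pi * of_int k)"
    by (simp only: cis_mult distrib_left)
  also have "cis (2 * pi * of_int k) = 1"
    by (rule cis_multiple_2pi) simp
  finally show ?thesis by (simp only: circle_point_def mult_1_right)
qed

lemma circle_point_eq_imp:
  assumes "circle_point c t = circle_point c s"
  shows "\<exists>k::int. t - s = of_int k"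
proof -
  have "cis (2 * pi * t) = cis (2 * pi * s)"
    using assms unfolding circle_point_def by (simp del: of_nat_Suc of_nat_add)
  then have "cis (2 * pi * t - 2 * pi * s) = 1"
    by (metis cis_divide cis_neq_zero divide_self)
  then have "cos (2 * pi * t - 2 * pi * s) = 1"
    by (metis cis.sel(1) one_complex.sel(1))
  then obtain k :: int where "2 * pi * t - 2 * pi * s = of_int k * 2 * pi"
    unfolding cos_one_2pi_int by blast
  then have "2 * pi * (t - s) = 2 * pi * of_int k" by (simp add: algebra_simps)
  then show ?thesis by auto
qed

lemma circle_point_int: "t \<in> \<int> \<Longrightarrow> circle_point c t = 0"
  by (simp add: circle_point_def)

text \<open>On the circle with centre and radius \<open>k\<close> the squared norm of
  \<open>z\<close> is \<open>2 * k * Re z\<close>, so a nonzero \<open>z\<close> determines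
  \<open>k\<close>.\<close>

lemma circle_point_disjoint:
  assumes "circle_point c t = circle_point d s" "circle_point c t \<noteq> 0"
  shows "c = d"
proof -
  define z where "z = circle_point c t"
  have sph: "(Re z)\<^sup>2 + (Im z)\<^sup>2 = 2 * real k * Re z" if "z \<in> sphere (of_nat k) (of_nat k)" for k
  proof -
    have "norm (z - of_nat k) = real k"
      using that by (simp add: dist_norm norm_minus_commute)
    then have "(norm (z - of_nat k))\<^sup>2 = (real k)\<^sup>2" by simp
    then have "(Re z - real k)\<^sup>2 + (Im z)\<^sup>2 = (real k)\<^sup>2"
      by (simp add: cmod_power2)
    then show ?thesis by (simp add: power2_eq_square algebra_simps)
  qed
  have zc: "z \<in> sphere (of_nat (c + 1)) (of_nat (c + 1))"
    unfolding z_def by (rule circle_point_in_sphere)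
  have zd: "z \<in> sphere (of_nat (d + 1)) (of_nat (d + 1))"
    unfolding z_def assms(1) by (rule circle_point_in_sphere)
  have "2 * real (c + 1) * Re z = 2 * real (d + 1) * Re z"
    using sph[OF zc] sph[OF zd] by (rule subst)
  moreover have "Re z \<noteq> 0"
  proof
    assume "Re z = 0"
    then have "z = 0"
      using sph[OF zc] by (simp add: complex_eq_iff)
    then show False using assms(2) by (simp add: z_def)
  qed
  ultimately show ?thesis by simp
qed

text \<open>To be applied to points with \<open>y j \<in> \<int>\<close>, whose omitted coordinate \<open>j\<close> is the base point.\<close>

definition circle_orbit :: "nat \<Rightarrow> nat \<Rightarrow> (nat \<Rightarrow> real) \<Rightarrow> complex multiset" where
  "circle_orbit n j y = image_mset (\<lambda>c. circle_point c (y c)) (mset_set ({..n} - {j}))"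

lemma in_circle_orbit_iff: "z \<in># circle_orbit n j y \<longleftrightarrow> (\<exists>c\<le>n. c \<noteq> j \<and> z = circle_point c (y c))"
  by (auto simp: circle_orbit_def)

text \<open>Adding the omitted base point gives the multiset of all \<open>n+1\<close> points, in
  which \<open>j\<close> no longer occurs. Hence the maps on the faces of the skeleton agree where
  faces meet.\<close>

lemma circle_orbit_indep:
  assumes "j \<le> n" "y j \<in> \<int>" "j' \<le> n" "y j' \<in> \<int>"
  shows "circle_orbit n j y = circle_orbit n j' y"
proof -
  have "add_mset 0 (circle_orbit n k y) = image_mset (\<lambda>c. circle_point c (y c)) (mset_set {..n})" if "k \<le> n" "y k \<in> \<int>" for k
  proof -
    have "mset_set {..n} = add_mset k (mset_set ({..n} - {k}))"
      using that by (intro mset_set.remove) auto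
    then show ?thesis using that by (simp add: circle_orbit_def circle_point_int)
  qed
  then show ?thesis using assms by (metis add_mset_add_mset_same_iff)
qed

lemma circle_orbit_cong:
  assumes "\<And>c. c \<le> n \<Longrightarrow> \<exists>k::int. y c - y' c = of_int k"
  shows "circle_orbit n j y = circle_orbit n j y'"
  unfolding circle_orbit_def
proof (rule image_mset_cong)
  fix c assume "c \<in># mset_set ({..n} - {j})"
  then have "c \<le> n" by simp
  then obtain k :: int where "y c = y' c + of_int k" using assms[of c] by (auto simp: algebra_simps)
  then show "circle_point c (y c) = circle_point c (y' c)" by (simp add: circle_point_shift)
qed

text \<open>Injectivity on the skeleton modulo integers: a member other than the base point reveals
  its circle, so forgetting the order loses nothing. Where one side is at the base point, the
  symmetric argument applies.\<close>

lemma circle_orbit_eq_imp: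
  assumes eq: "circle_orbit n j y = circle_orbit n j' y'" and j: "y j \<in> \<int>" "y' j' \<in> \<int>" and c: "c \<le> n"
  shows "\<exists>k::int. y c - y' c = of_int k"
proof -
  have *: "circle_point c (y c) = circle_point c (y' c)"
    if eq: "circle_orbit n j y = circle_orbit n j' y'" and j: "y j \<in> \<int>" and nz: "circle_point c (y c) \<noteq> 0" for y y' j j'
  proof -
    have "c \<noteq> j" using circle_point_int[OF j, of j] nz by auto
    then have "circle_point c (y c) \<in># circle_orbit n j' y'"
      using c eq by (metis in_circle_orbit_iff)
    then obtain d where "circle_point c (y c) = circle_point d (y' d)" by (auto simp: in_circle_orbit_iff)
    with circle_point_disjoint[OF this nz] show ?thesis by simp
  qed
  have "circle_point c (y c) = circle_point c (y' c)"
  proof (cases "circle_point c (y c) = 0")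
    case True
    with *[OF eq[symmetric] j(2)] show ?thesis by metis
  next
    case False
    with *[OF eq j(1)] show ?thesis by simp
  qed
  then show ?thesis by (rule circle_point_eq_imp)
qed

text \<open>A lift of \<open>circle_orbit\<close> to ordered tuples, where continuity can be checked
  by coordinates; positions from \<open>j\<close> on are shifted by one to skip circle
  \<open>j\<close>.\<close>

definition circle_tuple :: "nat \<Rightarrow> nat \<Rightarrow> (nat \<Rightarrow> real) \<Rightarrow> nat \<Rightarrow> complex" where
  "circle_tuple n j y = (\<lambda>k\<in>{..<n}. let c = (if k < j then k else k + 1) in circle_point c (y c))"

lemma orbit_of_tuple_circle_tuple:
  assumes "j \<le> n"
  shows "orbit_of_tuple n (circle_tuple n j y) = circle_orbit n j y"
proof -
  define s where "s k = (if k < j then k else k + 1)" for k :: nat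
  have im: "s ` {..<n} = {..n} - {j}"
  proof (intro equalityI subsetI)
    fix c assume "c \<in> {..n} - {j}"
    then have "c = s (if c < j then c else c - 1)" "(if c < j then c else c - 1) < n"
      using assms by (auto simp: s_def)
    then show "c \<in> s ` {..<n}" by blast
  qed (use assms in \<open>auto simp: s_def\<close>)
  have inj: "inj_on s {..<n}" by (auto simp: inj_on_def s_def split: if_splits)
  have "orbit_of_tuple n (circle_tuple n j y) = image_mset (\<lambda>k. circle_point (s k) (y (s k))) (mset_set {..<n})"
    unfolding orbit_of_tuple_def by (rule image_mset_cong) (simp add: circle_tuple_def s_def Let_def)
  also have "\<dots> = image_mset (\<lambda>c. circle_point c (y c)) (image_mset s (mset_set {..<n}))"
    by (simp add: image_mset.compositionality o_def)
  also have "\<dots> = circle_orbit n j y"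
    unfolding image_mset_mset_set[OF inj] im circle_orbit_def ..
  finally show ?thesis .
qed

lemma continuous_map_circle_tuple:
  assumes "j \<le> n"
  shows "continuous_map euclidean (product_topology (\<lambda>i. bouquet_top n) {..<n}) (circle_tuple n j)"
  unfolding continuous_map_componentwise
proof (intro conjI ballI)
  show "circle_tuple n j ` topspace euclidean \<subseteq> extensional {..<n}"
    by (auto simp: circle_tuple_def)
  fix k assume k: "k \<in> {..<n}"
  define c where "c = (if k < j then k else k + 1)"
  have "c \<le> n" using k by (auto simp: c_def)
  have "continuous_on UNIV (\<lambda>y::nat \<Rightarrow> real. circle_point c (y c))"
    unfolding circle_point_def
    by (intro continuous_intros continuous_on_product_coordinates)
  then have "continuous_map euclidean (bouquet_top n) (\<lambda>y. circle_point c (y c))"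
    using circle_point_in_bouquet[OF \<open>c \<le> n\<close>] by (simp add: bouquet_top_def continuous_map_in_subtopology)
  then show "continuous_map euclidean (bouquet_top n) (\<lambda>y. circle_tuple n j y k)"
    using k by (simp add: circle_tuple_def c_def Let_def)
qed

lemma continuous_map_circle_orbit:
  assumes "j \<le> n"
  shows "continuous_map euclidean (SP n (bouquet_top n)) (circle_orbit n j)"
proof -
  have "continuous_map euclidean (SP n (bouquet_top n)) (orbit_of_tuple n \<circ> circle_tuple n j)"
    unfolding SP_def by (rule continuous_map_compose[OF continuous_map_circle_tuple[OF assms] continuous_map_quotient_top])
  moreover have "orbit_of_tuple n \<circ> circle_tuple n j = circle_orbit n j"
    using orbit_of_tuple_circle_tuple[OF assms] by auto
  ultimately show ?thesis by simp
qed

section \<open>Compactness and fine covers\<close>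

text \<open>All coordinates are bounded, also those beyond \<open>n\<close>, so that the box is
  compact in \<open>nat \<Rightarrow> real\<close> by Tychonoff.\<close>

definition unit_box :: "(nat \<Rightarrow> real) set" where
  "unit_box = {y. \<forall>c. 0 \<le> y c \<and> y c \<le> 1}"

lemma compact_unit_box: "compact unit_box"
proof -
  have "unit_box = Pi\<^sub>E UNIV (\<lambda>_. {0..1})"
    by (auto simp: unit_box_def PiE_iff)
  moreover have "compactin (product_topology (\<lambda>_::nat. euclidean :: real topology) UNIV) (Pi\<^sub>E UNIV (\<lambda>_. {0..1}))"
    by (simp add: compactin_PiE)
  ultimately show ?thesis
    by (simp add: euclidean_product_topology)
qed

lemma tendsto_fun_iff:
  fixes X :: "'a \<Rightarrow> 'b \<Rightarrow> 'c::topological_space"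
  shows "(X \<longlongrightarrow> l) F \<longleftrightarrow> (\<forall>c. ((\<lambda>N. X N c) \<longlongrightarrow> l c) F)"
proof -
  have "(X \<longlongrightarrow> l) F \<longleftrightarrow> limitin (product_topology (\<lambda>_. euclidean) UNIV) X l F"
    by (simp add: euclidean_product_topology)
  also have "\<dots> \<longleftrightarrow> (\<forall>c. ((\<lambda>N. X N c) \<longlongrightarrow> l c) F)"
    by (simp add: limitin_componentwise)
  finally show ?thesis .
qed

text \<open>A Lebesgue number by sequential compactness: the centres of counterexamples accumulate
  at some \<open>l\<close>, and the nearby points that escape \<open>U\<close> then tend to
  \<open>l\<close> too, against openness of the preimage of \<open>U\<close>. The points
  \<open>y'\<close> may leave the box.\<close>

lemma lebesgue_unit_box:
  assumes F: "continuous_map euclidean Y F" and op: "\<And>U. U \<in> \<U> \<Longrightarrow> openin Y U" and cov: "\<Union>\<U> = topspace Y"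
  shows "\<exists>N::nat. \<forall>y\<in>unit_box. \<exists>U\<in>\<U>. \<forall>y'. (\<forall>c. \<bar>y' c - y c\<bar> \<le> 1 / (real N + 1)) \<longrightarrow> F y' \<in> U"
proof (rule ccontr)
  assume "\<not> ?thesis"
  then have "\<forall>N::nat. \<exists>y. y \<in> unit_box \<and> (\<forall>U\<in>\<U>. \<exists>y'. (\<forall>c. \<bar>y' c - y c\<bar> \<le> 1 / (real N + 1)) \<and> F y' \<notin> U)"
    by meson
  from choice[OF this] obtain y where y: "\<And>N. y N \<in> unit_box"
    and bad: "\<And>N U. U \<in> \<U> \<Longrightarrow> \<exists>y'. (\<forall>c. \<bar>y' c - y N c\<bar> \<le> 1 / (real N + 1)) \<and> F y' \<notin> U"
    by auto
  obtain l r where r: "strict_mono (r :: nat \<Rightarrow> nat)" and lim: "(y \<circ> r) \<longlonglongrightarrow> l"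
    using compact_imp_seq_compact[OF compact_unit_box] y unfolding seq_compact_def by metis
  have "F l \<in> topspace Y" using F by (auto simp: continuous_map_def)
  then obtain U where U: "U \<in> \<U>" "F l \<in> U" using cov by blast
  have "\<forall>N. \<exists>y'. (\<forall>c. \<bar>y' c - y N c\<bar> \<le> 1 / (real N + 1)) \<and> F y' \<notin> U"
    using bad[OF U(1)] by auto
  from choice[OF this] obtain z where z: "\<And>N c. \<bar>z N c - y N c\<bar> \<le> 1 / (real N + 1)" "\<And>N. F (z N) \<notin> U"
    by auto
  have "(\<lambda>N. z (r N) c) \<longlonglongrightarrow> l c" for c
  proof -
    have "(\<lambda>N. 1 / (real N + 1)) \<longlonglongrightarrow> 0" by real_asymp
    then have "(\<lambda>N. 1 / (real (r N) + 1)) \<longlonglongrightarrow> 0"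
      using LIMSEQ_subseq_LIMSEQ[OF _ r] by (fastforce simp: o_def)
    then have "(\<lambda>N. z (r N) c - y (r N) c) \<longlonglongrightarrow> 0"
      by (rule Lim_null_comparison[rotated]) (use z(1) in simp)
    moreover have "(\<lambda>N. y (r N) c) \<longlonglongrightarrow> l c"
      using lim by (simp add: tendsto_fun_iff o_def)
    ultimately show ?thesis using tendsto_add[of "\<lambda>N. z (r N) c - y (r N) c" 0 _ "\<lambda>N. y (r N) c" "l c"] by simp
  qed
  then have "(\<lambda>N. z (r N)) \<longlonglongrightarrow> l"
    by (simp add: tendsto_fun_iff)
  moreover have "open {x. F x \<in> U}" "l \<in> {x. F x \<in> U}"
    using openin_continuous_map_preimage[OF F op[OF U(1)]] U(2) by simp_all
  ultimately have "\<forall>\<^sub>F N in sequentially. z (r N) \<in> {x. F x \<in> U}"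
    by (rule topological_tendstoD)
  then show False using z(2) by (auto simp: eventually_sequentially)
qed

text \<open>Compactness turns pointwise difference into a uniform gap: a limit of ever closer pairs
  still differs in some factor \<open>i\<close>, and a third of that distance contradicts the
  triangle inequality.\<close>

lemma compact_separation:
  fixes F F' :: "nat \<Rightarrow> 'x::first_countable_topology \<Rightarrow> 'b"
  assumes S: "compact (S :: ('x \<times> 'x) set)"
    and M: "\<And>i. i < n \<Longrightarrow> Metric_space (M i) (d i)"
    and F: "\<And>i. i < n \<Longrightarrow> continuous_map euclidean (Metric_space.mtopology (M i) (d i)) (F i)"
    and F': "\<And>i. i < n \<Longrightarrow> continuous_map euclidean (Metric_space.mtopology (M i) (d i)) (F' i)"
    and ne: "\<And>y y'. (y, y') \<in> S \<Longrightarrow> \<exists>i<n. F i y \<noteq> F' i y'"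
  shows "\<exists>N::nat. \<forall>y y'. (y, y') \<in> S \<longrightarrow> (\<exists>i<n. d i (F i y) (F' i y') \<ge> 1 / (real N + 1))"
proof (rule ccontr)
  assume "\<not> ?thesis"
  then have "\<forall>N::nat. \<exists>p. p \<in> S \<and> (\<forall>i<n. d i (F i (fst p)) (F' i (snd p)) < 1 / (real N + 1))"
    by (auto simp: not_le)
  from choice[OF this] obtain p where p: "\<And>N. p N \<in> S"
    and close: "\<And>N i. i < n \<Longrightarrow> d i (F i (fst (p N))) (F' i (snd (p N))) < 1 / (real N + 1)"
    by auto
  obtain l r where l: "l \<in> S" and r: "strict_mono (r :: nat \<Rightarrow> nat)" and lim: "(p \<circ> r) \<longlonglongrightarrow> l"
    using compact_imp_seq_compact[OF S] p unfolding seq_compact_def by metis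
  obtain i where i: "i < n" "F i (fst l) \<noteq> F' i (snd l)" using ne[of "fst l" "snd l"] l by auto
  interpret Metric_space "M i" "d i" by (rule M[OF i(1)])
  have FM: "F i y \<in> M i" "F' i y \<in> M i" for y
    using F[OF i(1)] F'[OF i(1)] by (auto simp: continuous_map_def)
  define \<eta> where "\<eta> = d i (F i (fst l)) (F' i (snd l)) / 3"
  have \<eta>: "\<eta> > 0" using i(2) FM by (simp add: \<eta>_def mdist_pos_less)
  have 1: "limitin mtopology (F i \<circ> (\<lambda>N. fst (p (r N)))) (F i (fst l)) sequentially"
    by (rule continuous_map_limit[OF F[OF i(1)]])
       (use tendsto_fst[OF lim] in \<open>simp add: o_def\<close>)
  have 2: "limitin mtopology (F' i \<circ> (\<lambda>N. snd (p (r N)))) (F' i (snd l)) sequentially"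
    by (rule continuous_map_limit[OF F'[OF i(1)]])
       (use tendsto_snd[OF lim] in \<open>simp add: o_def\<close>)
  have "\<forall>\<^sub>F N in sequentially. d i (F i (fst (p (r N)))) (F i (fst l)) < \<eta>"
    using 1 \<eta> unfolding limitin_metric by (auto elim: eventually_mono)
  moreover have "\<forall>\<^sub>F N in sequentially. d i (F' i (snd (p (r N)))) (F' i (snd l)) < \<eta>"
    using 2 \<eta> unfolding limitin_metric by (auto elim: eventually_mono)
  moreover have "\<forall>\<^sub>F N in sequentially. 1 / (real (r N) + 1) < \<eta>"
  proof -
    have "(\<lambda>N. 1 / (real N + 1)) \<longlonglongrightarrow> 0" by real_asymp
    then have "(\<lambda>N. 1 / (real (r N) + 1)) \<longlonglongrightarrow> 0"
      using LIMSEQ_subseq_LIMSEQ[OF _ r] by (fastforce simp: o_def)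
    then show ?thesis using \<eta> by (rule order_tendstoD)
  qed
  ultimately have "\<forall>\<^sub>F N in sequentially. False"
  proof eventually_elim
    case (elim N)
    let ?a = "F i (fst (p (r N)))" and ?b = "F' i (snd (p (r N)))"
    have "d i (F i (fst l)) (F' i (snd l)) \<le> d i (F i (fst l)) ?a + d i ?a (F' i (snd l))"
      by (rule triangle) (rule FM)+
    moreover have "d i ?a (F' i (snd l)) \<le> d i ?a ?b + d i ?b (F' i (snd l))"
      by (rule triangle) (rule FM)+
    moreover have "d i (F i (fst l)) ?a = d i ?a (F i (fst l))" by (rule commute)
    ultimately show ?case
      using elim close[OF i(1), of "r N"] by (simp add: \<eta>_def)
  qed
  then show False by simp
qed

text \<open>Refining a finite cover by balls of radius \<open>\<epsilon> / 2\<close>; dimension at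
  most 1 allows at most two members at a point, so the nerve is a graph.\<close>

lemma fine_cover:
  assumes "Metric_space M d" and Y: "Y = Metric_space.mtopology M d" and "compact_space Y"
    and dim: "covering_dim_le Y 1" and "0 < \<epsilon>"
  shows "\<exists>\<V>. finite \<V> \<and> (\<forall>V\<in>\<V>. openin Y V) \<and> \<Union>\<V> = topspace Y \<and>
    (\<forall>V\<in>\<V>. \<forall>p\<in>V. \<forall>q\<in>V. d p q < \<epsilon>) \<and> (\<forall>x\<in>topspace Y. card {V \<in> \<V>. x \<in> V} \<le> 2)"
proof -
  interpret Metric_space M d by fact
  have top: "topspace Y = M" by (simp add: Y)
  define \<B> where "\<B> = (\<lambda>x. mball x (\<epsilon> / 2)) ` M"
  have "\<forall>U\<in>\<B>. openin Y U" by (auto simp: \<B>_def Y)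
  moreover have "topspace Y \<subseteq> \<Union>\<B>" using \<open>0 < \<epsilon>\<close> by (auto simp: \<B>_def top)
  ultimately obtain \<F> where \<F>: "finite \<F>" "\<F> \<subseteq> \<B>" "topspace Y \<subseteq> \<Union>\<F>"
    using \<open>compact_space Y\<close> unfolding compact_space_alt by metis
  have op: "\<forall>U\<in>\<F>. openin Y U" using \<F>(2) by (auto simp: \<B>_def Y)
  then have "\<Union>\<F> = topspace Y" using \<F>(3) openin_subset by blast
  with op \<F>(1) have "finite \<F> \<and> (\<forall>U\<in>\<F>. openin Y U) \<and> \<Union>\<F> = topspace Y" by simp
  from dim[unfolded covering_dim_le_def, THEN spec, THEN mp, OF this] obtain \<V> where \<V>: "finite \<V>" "\<forall>V\<in>\<V>. openin Y V" "\<Union>\<V> = topspace Y"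
      "\<forall>V\<in>\<V>. \<exists>U\<in>\<F>. V \<subseteq> U" "\<forall>x\<in>topspace Y. card {V\<in>\<V>. x \<in> V} \<le> 1 + 1"
    by (elim exE conjE)
  have "d p q < \<epsilon>" if V: "V \<in> \<V>" and pq: "p \<in> V" "q \<in> V" for V p q
  proof -
    obtain x where "V \<subseteq> mball x (\<epsilon> / 2)" using \<V>(4) V \<F>(2) by (auto simp: \<B>_def) blast
    then have "p \<in> mball x (\<epsilon> / 2)" "q \<in> mball x (\<epsilon> / 2)" using pq by auto
    then have *: "x \<in> M" "p \<in> M" "q \<in> M" "d x p < \<epsilon> / 2" "d x q < \<epsilon> / 2" by auto
    have "d p q \<le> d p x + d x q" by (rule triangle) (use * in auto)
    then show ?thesis using * commute[of p x] by linarith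
  qed
  with \<V> show ?thesis by (intro exI[of _ \<V>]) auto
qed

section \<open>Discretising an embedding\<close>

text \<open>The closed cube encoded by the lattice point \<open>x\<close>, scaled to mesh \<open>2 / R\<close>.\<close>

definition cell :: "int \<Rightarrow> (nat \<Rightarrow> int) \<Rightarrow> (nat \<Rightarrow> real) set" where
  "cell R x = {y. \<forall>c. if even (x c) then y c = of_int (x c) / of_int R
                       else \<bar>y c - of_int (x c) / of_int R\<bar> \<le> 1 / of_int R}"

lemma cell_center: "0 < R \<Longrightarrow> (\<lambda>c. of_int (x c) / of_int R) \<in> cell R x"
  by (simp add: cell_def)

lemma cell_near: "y \<in> cell R x \<Longrightarrow> 0 < R \<Longrightarrow> \<bar>y c - of_int (x c) / of_int R\<bar> \<le> 1 / of_int R"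
  unfolding cell_def by (drule CollectD, drule spec[of _ c]) (simp split: if_splits)

lemma grid_int: "R dvd a \<Longrightarrow> real_of_int a / of_int R \<in> \<int>"
  by (auto simp: dvd_def)

lemma cell_int: "y \<in> cell R x \<Longrightarrow> even R \<Longrightarrow> R dvd x j \<Longrightarrow> 0 < R \<Longrightarrow> y j \<in> \<int>"
  unfolding cell_def by (drule CollectD, drule spec[of _ j]) (auto elim!: dvdE)

lemma cell_mono:
  assumes "even (x k)" "s = 1 \<or> s = -1" "0 < R"
  shows "cell R x \<subseteq> cell R (x(k := x k + s))"
proof
  fix y assume y: "y \<in> cell R x"
  show "y \<in> cell R (x(k := x k + s))"
    unfolding cell_def
  proof (intro CollectI allI)
    fix c
    have yc: "if even (x c) then y c = of_int (x c) / of_int R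
        else \<bar>y c - of_int (x c) / of_int R\<bar> \<le> 1 / of_int R"
      using y unfolding cell_def by blast
    show "if even ((x(k := x k + s)) c) then y c = of_int ((x(k := x k + s)) c) / of_int R
        else \<bar>y c - of_int ((x(k := x k + s)) c) / of_int R\<bar> \<le> 1 / of_int R"
    proof (cases "c = k")
      case True
      then have "y k = of_int (x k) / of_int R" using yc assms(1) by simp
      then have "y k - of_int (x k + s) / of_int R = - (of_int s / of_int R)"
        by (simp add: add_divide_distrib)
      moreover have "odd (x k + s)" using assms(1,2) by auto
      moreover have "\<bar>- (real_of_int s / of_int R)\<bar> \<le> 1 / of_int R" using assms(2,3) by auto
      ultimately show ?thesis using True by simp
    next
      case False
      then show ?thesis using yc by simp
    qed
  qed
qed

lemma cell_shift:
  assumes "y \<in> cell R (x(k := x k + t * R))" "even R" "0 < R"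
  shows "y(k := y k - of_int t) \<in> cell R x"
  unfolding cell_def
proof (intro CollectI allI)
  fix c
  have yc: "if even ((x(k := x k + t * R)) c) then y c = of_int ((x(k := x k + t * R)) c) / of_int R
      else \<bar>y c - of_int ((x(k := x k + t * R)) c) / of_int R\<bar> \<le> 1 / of_int R"
    using assms(1) unfolding cell_def by blast
  show "if even (x c) then (y(k := y k - of_int t)) c = of_int (x c) / of_int R
      else \<bar>(y(k := y k - of_int t)) c - of_int (x c) / of_int R\<bar> \<le> 1 / of_int R"
  proof (cases "c = k")
    case True
    have eq: "real_of_int (x k + t * R) / of_int R = of_int (x k) / of_int R + of_int t"
      using assms(3) by (simp add: field_simps)
    have par: "even (x k + t * R) = even (x k)" using assms(2) by simp
    have assoc: "y k - of_int t - r = y k - (r + of_int t)" for r by simp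
    from yc show ?thesis
      unfolding True fun_upd_same par eq assoc by (cases "even (x k)") simp_all
  next
    case False
    with yc show ?thesis by (simp only: fun_upd_other simp_thms)
  qed
qed

text \<open>Labels shrink because a larger cube lies in fewer members of the cover;
  \<open>order\<close> at the centre of the cube bounds their size, \<open>leb\<close> makes them
  nonempty, and a common member in every factor forces closeness by \<open>sep\<close>.\<close>

lemma grid_coverI:
  fixes \<Phi> :: "nat \<Rightarrow> (nat \<Rightarrow> real) \<Rightarrow> 'b" and \<U> :: "nat \<Rightarrow> 'b set set"
  assumes n2: "2 \<le> n" and R: "even R" "16 \<le> R"
    and per: "\<And>i j y y'. i < n \<Longrightarrow> j \<le> n \<Longrightarrow> y j \<in> \<int> \<Longrightarrow> (\<And>c. c \<le> n \<Longrightarrow> \<exists>k::int. y c - y' c = of_int k) \<Longrightarrow> \<Phi> i y = \<Phi> i y'"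
    and leb: "\<And>i j y. i < n \<Longrightarrow> j \<le> n \<Longrightarrow> y \<in> unit_box \<Longrightarrow>
      \<exists>U\<in>\<U> i. \<forall>y'. y' j \<in> \<int> \<longrightarrow> (\<forall>c. \<bar>y' c - y c\<bar> \<le> 1 / of_int R) \<longrightarrow> \<Phi> i y' \<in> U"
    and fin: "\<And>i. i < n \<Longrightarrow> finite (\<U> i)"
    and order: "\<And>i j y. i < n \<Longrightarrow> j \<le> n \<Longrightarrow> y j \<in> \<int> \<Longrightarrow> card {U \<in> \<U> i. \<Phi> i y \<in> U} \<le> 2"
    and sep: "\<And>j j' c y y'. j \<le> n \<Longrightarrow> j' \<le> n \<Longrightarrow> c \<le> n \<Longrightarrow> y \<in> unit_box \<Longrightarrow> y' \<in> unit_box \<Longrightarrow> y j \<in> \<int> \<Longrightarrow> y' j' \<in> \<int> \<Longrightarrow>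
      (\<And>i. i < n \<Longrightarrow> \<exists>U\<in>\<U> i. \<Phi> i y \<in> U \<and> \<Phi> i y' \<in> U) \<Longrightarrow> \<exists>k::int. \<bar>y c - y' c - of_int k\<bar> < 1/8"
  shows "grid_cover n R (\<lambda>i x. {U \<in> \<U> i. \<forall>y\<in>cell R x. \<Phi> i y \<in> U})"
proof
  show "2 \<le> n" "even R" "16 \<le> R" by fact+
  have R0: "0 < R" using R by simp
  \<comment> \<open>The centre of the cell moved into \<open>unit_box\<close>, where
    \<open>leb\<close> and \<open>sep\<close> apply; coordinates beyond \<open>n\<close>, which
    \<open>per\<close> ignores, are set to 0.\<close>
  define fc where "fc x c = (if c \<le> n then frac (of_int (x c) / of_int R) else 0 :: real)" for x :: "nat \<Rightarrow> int" and c
  have fc: "fc x \<in> unit_box" for x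
    using frac_lt_1 less_imp_le by (auto simp: unit_box_def fc_def)
  have fc_int: "fc x j \<in> \<int>" if "R dvd x j" for x j
    using grid_int[OF that] by (simp add: fc_def)
  fix i j k x and s :: int
  {
    fix i j x assume i: "i < n" and j: "j \<le> n" and dvd: "R dvd x j"
    let ?G = "{U \<in> \<U> i. \<forall>y\<in>cell R x. \<Phi> i y \<in> U}"
    let ?y = "\<lambda>c. real_of_int (x c) / of_int R"
    have "?G \<subseteq> {U \<in> \<U> i. \<Phi> i ?y \<in> U}" using cell_center[OF R0] by auto
    moreover have "?y j \<in> \<int>" using dvd by (rule grid_int)
    ultimately have "card ?G \<le> 2"
      using order[OF i j, of ?y] fin[OF i] card_mono[of "{U \<in> \<U> i. \<Phi> i ?y \<in> U}" ?G] by simp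
    moreover have "?G \<noteq> {}"
    proof -
      obtain U where U: "U \<in> \<U> i" and *: "\<And>y'. y' j \<in> \<int> \<Longrightarrow> (\<And>c. \<bar>y' c - fc x c\<bar> \<le> 1 / of_int R) \<Longrightarrow> \<Phi> i y' \<in> U"
        using leb[OF i j fc[of x]] by blast
      have "\<Phi> i y \<in> U" if y: "y \<in> cell R x" for y
      proof -
        \<comment> \<open>Translating by the same integers as the centre keeps \<open>y'\<close>
          near \<open>fc x\<close> and, by \<open>per\<close>, does not change the value of
          \<open>\<Phi> i\<close>.\<close>
        define y' where "y' c = (if c \<le> n then y c - of_int \<lfloor>of_int (x c) / of_int R :: real\<rfloor> else 0)" for c
        have yj: "y j \<in> \<int>" by (rule cell_int[where j = j, OF y R(1) dvd R0])
        then have "y' j \<in> \<int>" using j by (simp add: y'_def)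
        moreover have "\<bar>y' c - fc x c\<bar> \<le> 1 / of_int R" for c
          using cell_near[OF y R0, of c] R0 by (auto simp: y'_def fc_def frac_def)
        ultimately have "\<Phi> i y' \<in> U" by (rule *)
        moreover have "\<Phi> i y = \<Phi> i y'"
          by (rule per[where y = y and j = j, OF i j yj]) (auto simp: y'_def)
        ultimately show ?thesis by simp
      qed
      with U show ?thesis by blast
    qed
    then have "card ?G \<noteq> 0" using fin[OF i] by simp
    ultimately show "card ?G = 1 \<or> card ?G = 2" by linarith
  }
  {
    fix x j assume i: "i < n" and j: "j \<le> n" and dvd: "R dvd x j" and k: "k \<le> n"
    have sub: "{U \<in> \<U> i. \<forall>y\<in>cell R x. \<Phi> i y \<in> U} \<subseteq> {U \<in> \<U> i. \<forall>y\<in>cell R (x(k := x k + t * R)). \<Phi> i y \<in> U}"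
      if dvd: "R dvd x j" for x t
    proof (intro Collect_mono impI conjI ballI)
      fix U y assume U: "U \<in> \<U> i \<and> (\<forall>y\<in>cell R x. \<Phi> i y \<in> U)" and y: "y \<in> cell R (x(k := x k + t * R))"
      have "R dvd (x(k := x k + t * R)) j" using dvd by (cases "j = k") simp_all
      then have yj: "y j \<in> \<int>" by (rule cell_int[where j = j, OF y R(1) _ R0])
      have "\<Phi> i y = \<Phi> i (y(k := y k - of_int t))"
        by (rule per[where y = y and j = j, OF i j yj]) auto
      moreover have "\<Phi> i (y(k := y k - of_int t)) \<in> U"
        using U cell_shift[OF y R(1) R0] by blast
      ultimately show "\<Phi> i y \<in> U" by simp
    qed auto
    show "{U \<in> \<U> i. \<forall>y\<in>cell R (x(k := x k + R)). \<Phi> i y \<in> U} = {U \<in> \<U> i. \<forall>y\<in>cell R x. \<Phi> i y \<in> U}"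
    proof (rule subset_antisym)
      have "R dvd (x(k := x k + R)) j" using dvd by (cases "j = k") simp_all
      from sub[where x = "x(k := x k + R)" and t = "-1", OF this]
      show "{U \<in> \<U> i. \<forall>y\<in>cell R (x(k := x k + R)). \<Phi> i y \<in> U} \<subseteq> {U \<in> \<U> i. \<forall>y\<in>cell R x. \<Phi> i y \<in> U}"
        by simp
      show "{U \<in> \<U> i. \<forall>y\<in>cell R x. \<Phi> i y \<in> U} \<subseteq> {U \<in> \<U> i. \<forall>y\<in>cell R (x(k := x k + R)). \<Phi> i y \<in> U}"
        using sub[where x = x and t = 1, OF dvd] by simp
    qed
  }
  show "{U \<in> \<U> i. \<forall>y\<in>cell R (x(k := x k + s)). \<Phi> i y \<in> U} \<subseteq> {U \<in> \<U> i. \<forall>y\<in>cell R x. \<Phi> i y \<in> U}"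
    if "even (x k)" "s = 1 \<or> s = -1"
    using cell_mono[where x = x and k = k, OF that R0] by blast
  {
    fix x y :: "nat \<Rightarrow> int" and j j' c
    assume j: "j \<le> n" "R dvd x j" and j': "j' \<le> n" "R dvd y j'" and c: "c \<le> n"
      and ne: "\<And>i. i < n \<Longrightarrow> {U \<in> \<U> i. \<forall>y\<in>cell R x. \<Phi> i y \<in> U} \<inter> {U \<in> \<U> i. \<forall>z\<in>cell R y. \<Phi> i z \<in> U} \<noteq> {}"
    have \<Phi>: "\<Phi> i (\<lambda>c. of_int (x c) / of_int R) = \<Phi> i (fc x)" if "i < n" "j \<le> n" "R dvd x j" for i j and x :: "nat \<Rightarrow> int"
    proof (rule per[where j = j, OF that(1,2)])
      show "of_int (x j) / real_of_int R \<in> \<int>"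
        using that(3) by (rule grid_int)
      show "\<exists>k::int. of_int (x c) / of_int R - fc x c = of_int k" if "c \<le> n" for c
        using that by (auto simp: fc_def frac_def)
    qed
    have "\<exists>k::int. \<bar>fc x c - fc y c - of_int k\<bar> < 1/8"
    proof (rule sep[OF j(1) j'(1) c fc fc fc_int fc_int])
      fix i assume i: "i < n"
      then obtain U where "U \<in> \<U> i" "\<forall>y\<in>cell R x. \<Phi> i y \<in> U" "\<forall>z\<in>cell R y. \<Phi> i z \<in> U"
        using ne by blast
      then show "\<exists>U\<in>\<U> i. \<Phi> i (fc x) \<in> U \<and> \<Phi> i (fc y) \<in> U"
        using cell_center[OF R0] unfolding \<Phi>[where x = x, OF i j, symmetric] \<Phi>[where x = y, OF i j', symmetric] by blast
    qed (use j j' in simp_all)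
    then obtain k :: int where k: "\<bar>fc x c - fc y c - of_int k\<bar> < 1/8" by blast
    define a b where "a = \<lfloor>of_int (x c) / of_int R :: real\<rfloor>" and "b = \<lfloor>of_int (y c) / of_int R :: real\<rfloor>"
    have "real_of_int (x c - y c) / of_int R - of_int (k + a - b) = fc x c - fc y c - of_int k"
      using c by (simp add: fc_def frac_def a_def b_def diff_divide_distrib)
    with k show "\<exists>k::int. \<bar>real_of_int (x c - y c) / of_int R - of_int k\<bar> < 1/8"
      by metis
  }
qed

text \<open>Lets thresholds found for finitely many indices separately be merged into one.\<close>

lemma eventually_if_mono:
  assumes "\<exists>N::nat. P N" "\<And>N N'. N \<le> N' \<Longrightarrow> P N \<Longrightarrow> P N'"
  shows "eventually P sequentially"
  using assms by (auto simp: eventually_sequentially)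

theorem mainTheorem19:
  fixes n :: nat and Y :: "nat \<Rightarrow> 'b topology"
  assumes "n \<ge> 2"
    and "\<forall>i<n. is_curve (Y i)"
  shows "\<not> (\<exists>f. embedding_map (SP n (bouquet_top n)) (product_topology Y {..<n}) f)"
proof
  assume "\<exists>f. embedding_map (SP n (bouquet_top n)) (product_topology Y {..<n}) f"
  then obtain f where "embedding_map (SP n (bouquet_top n)) (product_topology Y {..<n}) f" by blast
  then have contf: "continuous_map (SP n (bouquet_top n)) (product_topology Y {..<n}) f"
    and injf: "inj_on f (topspace (SP n (bouquet_top n)))"
    unfolding embedding_map_def
    by (auto dest: homeomorphic_imp_continuous_map homeomorphic_imp_injective_map simp: continuous_map_in_subtopology)
  have "\<forall>i. \<exists>M d. i < n \<longrightarrow> Metric_space M d \<and> Y i = Metric_space.mtopology M d"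
    using assms(2) unfolding is_curve_def metrizable_space_def by meson
  then obtain M d where Md: "\<And>i. i < n \<Longrightarrow> Metric_space (M i) (d i)"
      and Y: "\<And>i. i < n \<Longrightarrow> Y i = Metric_space.mtopology (M i) (d i)"
    by metis
  \<comment> \<open>For fixed \<open>j\<close> this is continuous on the whole space of functions,
    so the compactness arguments are carried out face by face, before gluing.\<close>
  define F where "F j i y = f (circle_orbit n j y) i" for j i y
  have contF: "continuous_map euclidean (Y i) (F j i)" if "j \<le> n" "i < n" for i j
    using continuous_map_compose[OF continuous_map_circle_orbit[OF that(1)] contf] that(2)
    by (simp add: continuous_map_componentwise F_def[abs_def] o_def)
  have F_top: "F j i y \<in> topspace (Y i)" if "j \<le> n" "i < n" for i j y
    using contF[OF that] by (auto simp: continuous_map_def)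
  have F_inj: "circle_orbit n j y = circle_orbit n j' y'"
    if "j \<le> n" "j' \<le> n" "\<And>i. i < n \<Longrightarrow> F j i y = F j' i y'" for j j' y y'
  proof (rule inj_onD[OF injf])
    show o: "circle_orbit n j y \<in> topspace (SP n (bouquet_top n))" "circle_orbit n j' y' \<in> topspace (SP n (bouquet_top n))"
      using continuous_map_circle_orbit that by (auto simp: continuous_map_def)
    show "f (circle_orbit n j y) = f (circle_orbit n j' y')"
    proof (rule PiE_ext)
      show "f (circle_orbit n j y) \<in> Pi\<^sub>E {..<n} (\<lambda>i. topspace (Y i))" "f (circle_orbit n j' y') \<in> Pi\<^sub>E {..<n} (\<lambda>i. topspace (Y i))"
        using contf o by (auto simp: continuous_map_def)
    qed (use that(3) in \<open>simp add: F_def\<close>)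
  qed
  \<comment> \<open>Pairs on the faces \<open>j\<close> and \<open>j'\<close> that are far apart
    modulo 1 in coordinate \<open>c\<close>; \<open>F_inj\<close> forces their images to
    differ.\<close>
  define S where "S j j' c = (unit_box \<times> unit_box) \<inter> {p. fst p j \<in> \<int>} \<inter> {p. snd p j' \<in> \<int>} \<inter>
      {p. \<forall>k::int. 1/8 \<le> \<bar>fst p c - snd p c - of_int k\<bar>}" for j j' c
  have compS: "compact (S j j' c)" for j j' c
  proof -
    have cont: "continuous_on UNIV (\<lambda>p::(nat \<Rightarrow> real) \<times> (nat \<Rightarrow> real). fst p c)"
      "continuous_on UNIV (\<lambda>p::(nat \<Rightarrow> real) \<times> (nat \<Rightarrow> real). snd p c)" for c
      by (rule continuous_on_product_then_coordinatewise,
          intro continuous_on_fst continuous_on_snd continuous_on_id)+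
    have "closed {p::(nat \<Rightarrow> real) \<times> (nat \<Rightarrow> real). fst p j \<in> \<int>}" "closed {p::(nat \<Rightarrow> real) \<times> (nat \<Rightarrow> real). snd p j' \<in> \<int>}"
      using closed_vimage[OF closed_Ints cont(1)] closed_vimage[OF closed_Ints cont(2)] by (simp_all add: vimage_def)
    moreover have "closed {p :: (nat \<Rightarrow> real) \<times> (nat \<Rightarrow> real). \<forall>k::int. 1/8 \<le> \<bar>fst p c - snd p c - of_int k\<bar>}"
      by (intro closed_Collect_all closed_Collect_le continuous_intros cont)
    ultimately show ?thesis
      unfolding S_def by (intro compact_Int_closed compact_Times compact_unit_box)
  qed
  define far where "far N j j' c \<longleftrightarrow>
      (\<forall>y y'. (y, y') \<in> S j j' c \<longrightarrow> (\<exists>i<n. d i (F j i y) (F j' i y') \<ge> 1 / (real N + 1)))" for N j j' c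
  have "eventually (\<lambda>N. far N j j' c) sequentially" if j: "j \<le> n" "j' \<le> n" and c: "c \<le> n" for j j' c
  proof (rule eventually_if_mono)
    show "\<exists>N. far N j j' c"
      unfolding far_def
    proof (rule compact_separation[OF compS Md])
      show "continuous_map euclidean (Metric_space.mtopology (M i) (d i)) (F j i)"
        "continuous_map euclidean (Metric_space.mtopology (M i) (d i)) (F j' i)" if "i < n" for i
        using contF j that by (simp_all add: Y[symmetric])
      fix y y' assume yS: "(y, y') \<in> S j j' c"
      show "\<exists>i<n. F j i y \<noteq> F j' i y'"
      proof (rule ccontr)
        assume "\<not> ?thesis"
        then have "circle_orbit n j y = circle_orbit n j' y'" using j by (intro F_inj) auto
        then obtain k :: int where "y c - y' c = of_int k"
          using circle_orbit_eq_imp[of n j y j' y' c] yS c by (auto simp: S_def)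
        moreover have "1/8 \<le> \<bar>y c - y' c - of_int k\<bar>" using yS by (auto simp: S_def)
        ultimately show False by simp
      qed
    qed simp
    show "far N' j j' c" if "N \<le> N'" "far N j j' c" for N N'
    proof -
      have "1 / (real N' + 1) \<le> 1 / (real N + 1)" using that(1) by (simp add: frac_le)
      then show ?thesis using that(2) unfolding far_def by (meson order_trans)
    qed
  qed
  then have "eventually (\<lambda>N. \<forall>j\<in>{..n}. \<forall>j'\<in>{..n}. \<forall>c\<in>{..n}. far N j j' c) sequentially"
    by (intro eventually_ball_finite finite_atMost ballI) simp_all
  then obtain N where "\<forall>j\<in>{..n}. \<forall>j'\<in>{..n}. \<forall>c\<in>{..n}. far N j j' c"
    using eventually_happens'[OF sequentially_bot] by blast
  then have N: "far N j j' c" if "j \<le> n" "j' \<le> n" "c \<le> n" for j j' c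
    using that by simp
  \<comment> \<open>The bound on diameters is the uniform gap: images that share a cover member in
    every factor cannot come from a far pair.\<close>
  have "\<forall>i. \<exists>\<V>. i < n \<longrightarrow> finite \<V> \<and> (\<forall>V\<in>\<V>. openin (Y i) V) \<and> \<Union>\<V> = topspace (Y i) \<and>
    (\<forall>V\<in>\<V>. \<forall>p\<in>V. \<forall>q\<in>V. d i p q < 1 / (real N + 1)) \<and> (\<forall>x\<in>topspace (Y i). card {V \<in> \<V>. x \<in> V} \<le> 2)"
  proof
    fix i
    show "\<exists>\<V>. i < n \<longrightarrow> finite \<V> \<and> (\<forall>V\<in>\<V>. openin (Y i) V) \<and> \<Union>\<V> = topspace (Y i) \<and>
    (\<forall>V\<in>\<V>. \<forall>p\<in>V. \<forall>q\<in>V. d i p q < 1 / (real N + 1)) \<and> (\<forall>x\<in>topspace (Y i). card {V \<in> \<V>. x \<in> V} \<le> 2)"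
    proof (cases "i < n")
      case True
      then have "compact_space (Y i)" "covering_dim_le (Y i) 1"
        using assms(2) by (auto simp: is_curve_def covering_dim_eq_def)
      from fine_cover[OF Md[OF True] Y[OF True] this, of "1 / (real N + 1)"]
      show ?thesis by (auto simp: True)
    qed simp
  qed
  from choice[OF this] obtain \<U> where \<U>_all: "\<forall>i. i < n \<longrightarrow> finite (\<U> i) \<and> (\<forall>V\<in>\<U> i. openin (Y i) V) \<and>
      \<Union>(\<U> i) = topspace (Y i) \<and> (\<forall>V\<in>\<U> i. \<forall>p\<in>V. \<forall>q\<in>V. d i p q < 1 / (real N + 1)) \<and>
      (\<forall>x\<in>topspace (Y i). card {V \<in> \<U> i. x \<in> V} \<le> 2)" ..
  have \<U>: "finite (\<U> i)" "\<And>V. V \<in> \<U> i \<Longrightarrow> openin (Y i) V" "\<Union>(\<U> i) = topspace (Y i)"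
      "\<And>V p q. V \<in> \<U> i \<Longrightarrow> p \<in> V \<Longrightarrow> q \<in> V \<Longrightarrow> d i p q < 1 / (real N + 1)"
      "\<And>x. x \<in> topspace (Y i) \<Longrightarrow> card {V \<in> \<U> i. x \<in> V} \<le> 2" if "i < n" for i
    using \<U>_all[THEN spec, THEN mp, OF that] by (elim conjE; blast)+
  define thin where "thin L i j \<longleftrightarrow> (\<forall>y\<in>unit_box. \<exists>U\<in>\<U> i. \<forall>y'. (\<forall>c. \<bar>y' c - y c\<bar> \<le> 1 / (real L + 1)) \<longrightarrow> F j i y' \<in> U)" for L i j
  have "eventually (\<lambda>L. thin L i j) sequentially" if i: "i < n" and j: "j \<le> n" for i j
  proof (rule eventually_if_mono)
    show "\<exists>L. thin L i j"
      unfolding thin_def by (rule lebesgue_unit_box[OF contF[OF j i] \<U>(2)[OF i] \<U>(3)[OF i]])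
    show "thin L' i j" if "L \<le> L'" "thin L i j" for L L'
    proof -
      have "1 / (real L' + 1) \<le> 1 / (real L + 1)" using that(1) by (simp add: frac_le)
      then show ?thesis using that(2) unfolding thin_def by (meson order_trans)
    qed
  qed
  then have "eventually (\<lambda>L. \<forall>i\<in>{..<n}. \<forall>j\<in>{..n}. thin L i j) sequentially"
    by (intro eventually_ball_finite finite_atMost finite_lessThan ballI) simp_all
  then obtain L where "\<forall>i\<in>{..<n}. \<forall>j\<in>{..n}. thin L i j"
    using eventually_happens'[OF sequentially_bot] by blast
  then have L: "thin L i j" if "i < n" "j \<le> n" for i j
    using that by simp
  \<comment> \<open>The factor 16 gives evenness and the bound on step lengths; \<open>L + 1\<close>
    makes the radius \<open>1 / R\<close> of a cell at most the Lebesgue number.\<close>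
  define R where "R = 16 * (int L + 1)"
  have RL: "1 / real_of_int R \<le> 1 / (real L + 1)"
    by (simp add: R_def frac_le)
  \<comment> \<open>The faces are glued by choosing some integer coordinate; on the skeleton the
    choice has no effect, by \<open>circle_orbit_indep\<close>.\<close>
  define J where "J y = (SOME j. j \<le> n \<and> y j \<in> \<int>)" for y :: "nat \<Rightarrow> real"
  define \<Phi> where "\<Phi> i y = F (J y) i y" for i y
  have \<Phi>: "\<Phi> i y = F j i y" if "j \<le> n" "y j \<in> \<int>" for i j y
  proof -
    have "J y \<le> n \<and> y (J y) \<in> \<int>"
      unfolding J_def by (rule someI[of _ j]) (use that in simp)
    then show ?thesis
      unfolding \<Phi>_def F_def using circle_orbit_indep[of "J y" n y j] that by simp
  qed
  have "grid_cover n R (\<lambda>i x. {U \<in> \<U> i. \<forall>y\<in>cell R x. \<Phi> i y \<in> U})"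
  proof (rule grid_coverI)
    show "2 \<le> n" "even R" "16 \<le> R" using assms(1) by (simp_all add: R_def)
  next
    fix i j and y y' :: "nat \<Rightarrow> real"
    assume j: "j \<le> n" and yj: "y j \<in> \<int>" and eq: "\<And>c. c \<le> n \<Longrightarrow> \<exists>k::int. y c - y' c = of_int k"
    obtain k :: int where "y j - y' j = of_int k" using eq[OF j] by blast
    then have "y' j = y j - of_int k" by simp
    then have "y' j \<in> \<int>" using yj by simp
    then show "\<Phi> i y = \<Phi> i y'"
      unfolding \<Phi>[where y = y, OF j yj] \<Phi>[where y = y', OF j \<open>y' j \<in> \<int>\<close>] F_def using circle_orbit_cong[of n y y', OF eq] by simp
  next
    fix i j and y :: "nat \<Rightarrow> real" assume i: "i < n" and j: "j \<le> n" and y: "y \<in> unit_box"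
    obtain U where U: "U \<in> \<U> i" "\<And>y'. (\<And>c. \<bar>y' c - y c\<bar> \<le> 1 / (real L + 1)) \<Longrightarrow> F j i y' \<in> U"
      using L[OF i j] y unfolding thin_def by blast
    have "\<Phi> i y' \<in> U" if "y' j \<in> \<int>" "\<forall>c. \<bar>y' c - y c\<bar> \<le> 1 / real_of_int R" for y'
      unfolding \<Phi>[where y = y', OF j that(1)] by (rule U(2)) (use that(2) RL order_trans in blast)
    with U(1) show "\<exists>U\<in>\<U> i. \<forall>y'. y' j \<in> \<int> \<longrightarrow> (\<forall>c. \<bar>y' c - y c\<bar> \<le> 1 / of_int R) \<longrightarrow> \<Phi> i y' \<in> U"
      by blast
  next
    show "finite (\<U> i)" if "i < n" for i by (rule \<U>(1)[OF that])
  next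
    fix i j and y :: "nat \<Rightarrow> real" assume i: "i < n" and j: "j \<le> n" "y j \<in> \<int>"
    show "card {U \<in> \<U> i. \<Phi> i y \<in> U} \<le> 2"
      unfolding \<Phi>[where y = y, OF j] by (rule \<U>(5)[OF i F_top[OF j(1) i]])
  next
    fix j j' c and y y' :: "nat \<Rightarrow> real"
    assume j: "j \<le> n" "j' \<le> n" and c: "c \<le> n" and y: "y \<in> unit_box" "y' \<in> unit_box" "y j \<in> \<int>" "y' j' \<in> \<int>"
      and near: "\<And>i. i < n \<Longrightarrow> \<exists>U\<in>\<U> i. \<Phi> i y \<in> U \<and> \<Phi> i y' \<in> U"
    show "\<exists>k::int. \<bar>y c - y' c - of_int k\<bar> < 1/8"
    proof (rule ccontr)
      assume "\<not> ?thesis"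
      then have "(y, y') \<in> S j j' c" using y by (auto simp: S_def not_less)
      then obtain i where i: "i < n" "1 / (real N + 1) \<le> d i (F j i y) (F j' i y')"
        using N[OF j c] unfolding far_def by blast
      obtain U where "U \<in> \<U> i" "F j i y \<in> U" "F j' i y' \<in> U"
        using near[OF i(1)] unfolding \<Phi>[where y = y, OF j(1) y(3)] \<Phi>[where y = y', OF j(2) y(4)] by blast
      then have "d i (F j i y) (F j' i y') < 1 / (real N + 1)" by (rule \<U>(4)[OF i(1)])
      with i(2) show False by simp
    qed
  qed
  then show False by (rule grid_cover.inconsistent)
qed

end
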